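(* (Taylor) Suppose $[a,b]\subset\mathbb{R}$. Let $f:[a,b]\to\mathbb{R}$ and let $n\ge0$ be an integer. If $f^{(n)}\in C^0([a,b])$ then for all $x\in[a,b]$ we have $f(x)=P_n(x)+R_n(x)$ where $$P_n(x)=\sum_{k=0}^n\frac{f^{(k)}(a)(x-a)^k}{k!}\qquad\text{and}\qquad R_n(x)=\frac1{n!}\int_a^x f^{(n+1)}(t)(x-t)^n\,dt.$$ For each $x\in[a,b]$ we have the estimate $$|R_n(x)|\le\frac{(x-a)^n\|f^{(n+1)}\chi_{[a,x]}\|}{n!}=\frac{(x-a)^n}{n!}\max_{a\le\xi\le x}|f^{(n)}(\xi)-f^{(n)}(a)|\le\frac{(x-a)^n\|f^{(n+1)}\|}{n!}.$$ And, $$\|R_n\|\le\|R_n\|_1\le\frac{(b-a)^{n+1}}{(n+1)!}\|f^{(n+1)}\|=\frac{(b-a)^{n+1}}{(n+1)!}\max_{a\le\xi\le b}|f^{(n)}(\xi)-f^{(n)}(a)|.$$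
   Context: For $k\le n$, $f^{(k)}$ is the ordinary $k$-th derivative; $f^{(n+1)}$ denotes the distributional derivative of the continuous function $f^{(n)}$ in $\mathcal{D}'((a,b))$ (the dual of $C_c^\infty((a,b))$, with $\langle T',\phi\rangle=-\langle T,\phi'\rangle$). A distribution $h\in\mathcal{D}'((a,b))$ is integrable on $[a,b]$ if $h=H'$ for some $H\in C^0([a,b])$; then $\int_c^d h=H(d)-H(c)$ for $a\le c\le d\le b$. Its Alexiewicz norm is $\|h\|=\max_{a\le x\le b}|\int_a^x h|=\max_{a\le x\le b}|H(x)-H(a)|$; thus $\|h\chi_{[a,x]}\|=\max_{a\le\xi\le x}|H(\xi)-H(a)|$. If $g$ is of bounded variation on $[c,d]\subset[a,b]$, then by definition $\int_c^d hg=H(d)g(d)-H(c)g(c)-\int_c^d H\,dg$ (Riemann–Stieltjes integral). The integral defining $R_n(x)$ is understood in this sense with $h=f^{(n+1)}$, $H=f^{(n)}$, $g(t)=(x-t)^n$, where for $n=0$ we take $(x-t)^0=1$ (and likewise $(x-a)^0=1$). $\|R_n\|$ is the Alexiewicz norm of the function $R_n$ on $[a,b]$, i.e. $\|R_n\|=\max_{a\le x\le b}|\int_a^xR_n(t)\,dt|$, and $\|R_n\|_1=\int_a^b|R_n|$. *)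

theory Defs
  imports "HOL-Analysis.Analysis" "HOL-Library.FuncSet"
begin

text \<open>
  Distributions on the open interval from \<open>a\<close> to \<open>b\<close> are functionals that are undefined off the
  test functions (in the sense of \<^const>\<open>extensional\<close>), so that equality of distributions is equality
  in the logic. Test functions are extended by 0 to the whole line.
\<close>

definition test_functions :: "real \<Rightarrow> real \<Rightarrow> (real \<Rightarrow> real) set" where
  "test_functions a b =
    {\<phi>. (\<forall>k t. (deriv ^^ k) \<phi> differentiable (at t)) \<and>
        compact (closure {t. \<phi> t \<noteq> 0}) \<and> closure {t. \<phi> t \<noteq> 0} \<subseteq> {a<..<b}}"

definition test_converges ::
    "real \<Rightarrow> real \<Rightarrow> (nat \<Rightarrow> real \<Rightarrow> real) \<Rightarrow> (real \<Rightarrow> real) \<Rightarrow> bool" where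
  "test_converges a b \<phi>s \<phi> \<longleftrightarrow>
    (\<exists>K. compact K \<and> K \<subseteq> {a<..<b} \<and> (\<forall>j. {t. \<phi>s j t \<noteq> 0} \<subseteq> K)) \<and>
    (\<forall>k. uniform_limit UNIV (\<lambda>j. (deriv ^^ k) (\<phi>s j)) ((deriv ^^ k) \<phi>) sequentially)"

text \<open>For linear functionals on test functions, continuity is the same as sequential continuity.\<close>

definition distributions :: "real \<Rightarrow> real \<Rightarrow> ((real \<Rightarrow> real) \<Rightarrow> real) set" where
  "distributions a b =
    {T \<in> extensional (test_functions a b).
      (\<forall>\<phi>\<in>test_functions a b. \<forall>\<psi>\<in>test_functions a b. \<forall>c d.
        T (\<lambda>t. c * \<phi> t + d * \<psi> t) = c * T \<phi> + d * T \<psi>) \<and>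
      (\<forall>\<phi>s. \<forall>\<phi>\<in>test_functions a b.
        (\<forall>j. \<phi>s j \<in> test_functions a b) \<longrightarrow> test_converges a b \<phi>s \<phi> \<longrightarrow>
        (\<lambda>j. T (\<phi>s j)) \<longlonglongrightarrow> T \<phi>)}"

definition dist_of :: "real \<Rightarrow> real \<Rightarrow> (real \<Rightarrow> real) \<Rightarrow> (real \<Rightarrow> real) \<Rightarrow> real" where
  "dist_of a b F = (\<lambda>\<phi>\<in>test_functions a b. integral {a..b} (\<lambda>t. F t * \<phi> t))"

definition dist_deriv ::
    "real \<Rightarrow> real \<Rightarrow> ((real \<Rightarrow> real) \<Rightarrow> real) \<Rightarrow> (real \<Rightarrow> real) \<Rightarrow> real" where
  "dist_deriv a b T = (\<lambda>\<phi>\<in>test_functions a b. - T (deriv \<phi>))"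

definition is_dist_primitive ::
    "real \<Rightarrow> real \<Rightarrow> ((real \<Rightarrow> real) \<Rightarrow> real) \<Rightarrow> (real \<Rightarrow> real) \<Rightarrow> bool" where
  "is_dist_primitive a b h H \<longleftrightarrow>
    h \<in> distributions a b \<and> continuous_on {a..b} H \<and> h = dist_deriv a b (dist_of a b H)"

text \<open>
  A distribution is integrable iff it has such a primitive. Primitives are unique on the closed
  interval up to an additive constant, on which the integrals below do not depend.
\<close>

definition dist_primitive :: "real \<Rightarrow> real \<Rightarrow> ((real \<Rightarrow> real) \<Rightarrow> real) \<Rightarrow> real \<Rightarrow> real" where
  "dist_primitive a b h = (SOME H. is_dist_primitive a b h H)"

definition dist_integral ::
    "real \<Rightarrow> real \<Rightarrow> ((real \<Rightarrow> real) \<Rightarrow> real) \<Rightarrow> real \<Rightarrow> real \<Rightarrow> real" where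
  "dist_integral a b h c d = dist_primitive a b h d - dist_primitive a b h c"

text \<open>The Riemann--Stieltjes integral of \<open>H\<close> with respect to \<open>g\<close>, as the limit over the mesh.\<close>

definition has_RS_integral ::
    "(real \<Rightarrow> real) \<Rightarrow> (real \<Rightarrow> real) \<Rightarrow> real \<Rightarrow> real \<Rightarrow> real \<Rightarrow> bool" where
  "has_RS_integral H g c d I \<longleftrightarrow>
    (\<forall>\<epsilon>>0. \<exists>\<delta>>0. \<forall>p. p tagged_division_of {c..d} \<longrightarrow> (\<forall>(t, K)\<in>p. Sup K - Inf K < \<delta>) \<longrightarrow>
      \<bar>(\<Sum>(t, K)\<in>p. H t * (g (Sup K) - g (Inf K))) - I\<bar> < \<epsilon>)"

definition RS_integral ::
    "(real \<Rightarrow> real) \<Rightarrow> (real \<Rightarrow> real) \<Rightarrow> real \<Rightarrow> real \<Rightarrow> real" where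
  "RS_integral H g c d = (THE I. has_RS_integral H g c d I)"

definition dist_integral_mult ::
    "real \<Rightarrow> real \<Rightarrow> ((real \<Rightarrow> real) \<Rightarrow> real) \<Rightarrow> (real \<Rightarrow> real) \<Rightarrow> real \<Rightarrow> real \<Rightarrow> real" where
  "dist_integral_mult a b h g c d =
    (let H = dist_primitive a b h in H d * g d - H c * g c - RS_integral H g c d)"

text \<open>
  The product of an integrable distribution and a function of bounded variation is the integrable
  distribution whose indefinite integral is the integral above.
\<close>

definition dist_mult ::
    "real \<Rightarrow> real \<Rightarrow> ((real \<Rightarrow> real) \<Rightarrow> real) \<Rightarrow> (real \<Rightarrow> real) \<Rightarrow> (real \<Rightarrow> real) \<Rightarrow> real" where
  "dist_mult a b h g = dist_deriv a b (dist_of a b (dist_integral_mult a b h g a))"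

text \<open>An attained maximum; unspecified if the supremum is not attained.\<close>

definition max_on :: "'a set \<Rightarrow> ('a \<Rightarrow> real) \<Rightarrow> real" where
  "max_on S F = (GREATEST y. y \<in> F ` S)"

definition alexiewicz_norm :: "real \<Rightarrow> real \<Rightarrow> ((real \<Rightarrow> real) \<Rightarrow> real) \<Rightarrow> real" where
  "alexiewicz_norm a b h = max_on {a..b} (\<lambda>x. \<bar>dist_integral a b h a x\<bar>)"

definition alexiewicz_norm_fun :: "real \<Rightarrow> real \<Rightarrow> (real \<Rightarrow> real) \<Rightarrow> real" where
  "alexiewicz_norm_fun a b F = max_on {a..b} (\<lambda>x. \<bar>integral {a..x} F\<bar>)"

definition L1_norm :: "real \<Rightarrow> real \<Rightarrow> (real \<Rightarrow> real) \<Rightarrow> real" where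
  "L1_norm a b F = integral {a..b} (\<lambda>x. \<bar>F x\<bar>)"

text \<open>Derivatives on the closed interval, one-sided at the endpoints.\<close>

definition nth_deriv :: "real \<Rightarrow> real \<Rightarrow> nat \<Rightarrow> (real \<Rightarrow> real) \<Rightarrow> real \<Rightarrow> real" where
  "nth_deriv a b k f = ((\<lambda>g t. vector_derivative g (at t within {a..b})) ^^ k) f"

definition nth_deriv_continuous :: "real \<Rightarrow> real \<Rightarrow> nat \<Rightarrow> (real \<Rightarrow> real) \<Rightarrow> bool" where
  "nth_deriv_continuous a b n f \<longleftrightarrow>
    (\<forall>k<n. \<forall>t\<in>{a..b}. nth_deriv a b k f differentiable (at t within {a..b})) \<and>
    continuous_on {a..b} (nth_deriv a b n f)"

text \<open>The derivative of order \<open>n + 1\<close>, as the distributional derivative of that of order \<open>n\<close>.\<close>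

definition dist_deriv_Suc :: "real \<Rightarrow> real \<Rightarrow> nat \<Rightarrow> (real \<Rightarrow> real) \<Rightarrow> (real \<Rightarrow> real) \<Rightarrow> real" where
  "dist_deriv_Suc a b n f = dist_deriv a b (dist_of a b (nth_deriv a b n f))"

definition taylor_poly :: "real \<Rightarrow> real \<Rightarrow> nat \<Rightarrow> (real \<Rightarrow> real) \<Rightarrow> real \<Rightarrow> real" where
  "taylor_poly a b n f x = (\<Sum>k=0..n. nth_deriv a b k f a * (x - a) ^ k / fact k)"

definition taylor_remainder :: "real \<Rightarrow> real \<Rightarrow> nat \<Rightarrow> (real \<Rightarrow> real) \<Rightarrow> real \<Rightarrow> real" where
  "taylor_remainder a b n f x =
    1 / fact n * dist_integral_mult a b (dist_deriv_Suc a b n f) (\<lambda>t. (x - t) ^ n) a x"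

end

theory Submission
  imports Defs
begin

text \<open>
  A continuous function on \<open>[a, b]\<close> that annihilates all derivatives of test functions is constant:
  test it against \<open>S ((t - c) / \<epsilon>) - S ((t - d) / \<epsilon>)\<close>, where \<open>S\<close> is a smooth step, so that the derivative
  is the difference of two approximate point masses. Hence every primitive of the distributional
  derivative of \<open>F\<close> is \<open>F + C\<close>. For continuously differentiable \<open>g\<close> the Stieltjes integral reduces to
  an ordinary one, and the formula is Taylor's theorem of order \<open>n - 1\<close> with the integral
  remainder. The estimates hold because \<open>(x - t) ^ n\<close> is nonnegative and decreasing in \<open>t\<close>.
\<close>

subsection \<open>Smooth functions\<close>

text \<open>The obstacle is that \<open>dist_primitive\<close> is an arbitrary choice, so only
  increments of a primitive are known. Hence the normalisation by \<open>F a\<close>: in the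
  integral of \<open>(F t - F a) * g' t\<close> the unknown constant has cancelled, and the same
  quantity \<open>F t - F a\<close> is what the norms measure. In the Taylor formula this
  normalisation splits off \<open>F a * (x - a) ^ n / fact n\<close>, exactly the last summand of
  the polynomial, which an integral remainder of order \<open>n - 1\<close> lacks. Approximate point
  masses can be centred only at interior points, because test functions vanish near the end points;
  the values at \<open>a\<close> and \<open>b\<close>, on which every integral depends, are
  recovered by continuity. The cut-off to \<open>{a..x}\<close> is not a continuously differentiable
  multiplier, so it gets a Stieltjes integral of its own, with a single jump.\<close>

definition smooth :: "(real \<Rightarrow> real) \<Rightarrow> bool" where
  "smooth f \<longleftrightarrow> (\<forall>k t. (deriv ^^ k) f differentiable (at t))"

lemma smooth_iff_deriv: "smooth f \<longleftrightarrow> (\<forall>t. f differentiable (at t)) \<and> smooth (deriv f)"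
proof
  assume f: "smooth f"
  have "(deriv ^^ k) (deriv f) differentiable (at t)" for k t
    using f unfolding smooth_def by (metis comp_apply funpow_Suc_right)
  moreover have "f differentiable (at t)" for t
    using f unfolding smooth_def by (metis funpow_0)
  ultimately show "(\<forall>t. f differentiable (at t)) \<and> smooth (deriv f)"
    by (simp add: smooth_def)
next
  assume f: "(\<forall>t. f differentiable (at t)) \<and> smooth (deriv f)"
  have "(deriv ^^ k) f differentiable (at t)" for k t
    using f by (cases k) (auto simp: smooth_def funpow_Suc_right simp del: funpow.simps)
  then show "smooth f" by (simp add: smooth_def)
qed

lemma smooth_deriv: "smooth f \<Longrightarrow> smooth (deriv f)"
  using smooth_iff_deriv by blast

text \<open>Avoids a closed formula for the iterated derivatives, which the bump functions do not
  have in manageable form: it is enough that all iterates stay in one family.\<close>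

lemma smooth_if_closed_under_deriv:
  assumes "\<And>g t. g \<in> S \<Longrightarrow> g differentiable (at t)" "\<And>g. g \<in> S \<Longrightarrow> deriv g \<in> S" "f \<in> S"
  shows "smooth f"
proof -
  have "(deriv ^^ k) f \<in> S" for k
    by (induction k) (use assms in auto)
  then show ?thesis
    using assms(1) by (auto simp: smooth_def)
qed

lemma smooth_has_deriv:
  assumes "smooth f"
  shows "(f has_real_derivative deriv f t) (at t)"
  using assms smooth_iff_deriv by (metis DERIV_deriv_iff_real_differentiable)

lemma smooth_continuous_on:
  assumes "smooth f"
  shows "continuous_on A f"
  by (meson DERIV_isCont assms continuous_at_imp_continuous_on smooth_has_deriv)

lemma deriv_funpow_lincomb:
  fixes f g :: "real \<Rightarrow> real"
  assumes "smooth f" "smooth g"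
  shows "(deriv ^^ k) (\<lambda>t. c * f t + d * g t) = (\<lambda>t. c * (deriv ^^ k) f t + d * (deriv ^^ k) g t)"
proof (induction k)
  case (Suc k)
  have "deriv (\<lambda>t. c * (deriv ^^ k) f t + d * (deriv ^^ k) g t) t
      = c * deriv ((deriv ^^ k) f) t + d * deriv ((deriv ^^ k) g) t" for t
  proof (rule DERIV_imp_deriv)
    have "((deriv ^^ k) f has_real_derivative deriv ((deriv ^^ k) f) t) (at t)"
      "((deriv ^^ k) g has_real_derivative deriv ((deriv ^^ k) g) t) (at t)"
      using assms by (auto simp: smooth_def DERIV_deriv_iff_real_differentiable)
    then show "((\<lambda>t. c * (deriv ^^ k) f t + d * (deriv ^^ k) g t) has_real_derivative
        c * deriv ((deriv ^^ k) f) t + d * deriv ((deriv ^^ k) g) t) (at t)"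
      by (intro DERIV_add DERIV_cmult)
  qed
  then show ?case using Suc by auto
qed simp

lemma smooth_lincomb:
  fixes f g :: "real \<Rightarrow> real"
  assumes "smooth f" "smooth g"
  shows "smooth (\<lambda>t. c * f t + d * g t)"
  using assms deriv_funpow_lincomb[OF assms] unfolding smooth_def
  by (auto intro!: derivative_intros)

lemma smooth_affine:
  fixes f :: "real \<Rightarrow> real"
  assumes "smooth f"
  shows "smooth (\<lambda>t. f (c * t + d))"
proof -
  have D: "((\<lambda>t. c ^ k * (deriv ^^ k) f (c * t + d)) has_real_derivative
     c ^ Suc k * (deriv ^^ Suc k) f (c * t + d)) (at t)" for k t
  proof -
    have "((deriv ^^ k) f has_real_derivative (deriv ^^ Suc k) f (c * t + d)) (at (c * t + d))"
      using assms by (auto simp: smooth_def DERIV_deriv_iff_real_differentiable)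
    moreover have "((\<lambda>t. c * t + d) has_real_derivative c) (at t)"
      by (auto intro!: derivative_eq_intros)
    ultimately show ?thesis
      by (auto intro!: derivative_eq_intros DERIV_chain2[where f = "(deriv ^^ k) f"])
  qed
  have "(deriv ^^ k) (\<lambda>t. f (c * t + d)) = (\<lambda>t. c ^ k * (deriv ^^ k) f (c * t + d))" for k
  proof (induction k)
    case (Suc k)
    then show ?case using DERIV_imp_deriv[OF D[of k]] by auto
  qed simp
  then show ?thesis
    unfolding smooth_def using D by (metis real_differentiable_def)
qed

text \<open>The functions \<open>bump p m\<close> are closed under differentiation, hence smooth.\<close>

definition bump :: "real poly \<Rightarrow> nat \<Rightarrow> real \<Rightarrow> real" where
  "bump p m x = (if \<bar>x\<bar> < 1 then poly p x * exp (- 1 / (1 - x\<^sup>2)) / (1 - x\<^sup>2) ^ m else 0)"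

text \<open>The exponential series at \<open>1 / u\<close> dominates its single term of index
  \<open>m + 2\<close>; take reciprocals. The index exceeds \<open>m\<close> by 2 so that a factor
  \<open>u\<^sup>2\<close> survives the division by \<open>u ^ m\<close>.\<close>

lemma exp_neg_inverse_over_power_le:
  fixes u :: real
  assumes "0 < u"
  shows "exp (- 1 / u) / u ^ m \<le> fact (m + 2) * u\<^sup>2"
proof -
  have "(1 / u) ^ (m + 2) / fact (m + 2) \<le> exp (1 / u)"
  proof -
    have "(\<Sum>k\<in>{m + 2}. (1 / u) ^ k /\<^sub>R fact k) \<le> (\<Sum>k. (1 / u) ^ k /\<^sub>R fact k)"
      using assms by (intro sum_le_suminf summable_exp_generic) auto
    then show ?thesis by (simp add: exp_def divide_inverse mult.commute)
  qed
  then have "1 \<le> fact (m + 2) * exp (1 / u) * u ^ (m + 2)"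
    using assms by (simp add: power_divide pos_divide_le_eq mult_ac del: fact_Suc power_Suc)
  then show ?thesis
    using assms by (simp add: exp_minus divide_simps power_add power2_eq_square mult_ac del: fact_Suc)
qed

text \<open>Measures how flat the bump is as seen from any point \<open>x\<close> outside the open
  interval, so that the boundary points and the exterior need no separate treatment.\<close>

lemma bump_quadratic_bound:
  obtains C where "\<And>x y. 1 \<le> \<bar>x\<bar> \<Longrightarrow> \<bar>bump p m y\<bar> \<le> C * (y - x)\<^sup>2"
proof -
  have "bounded (poly p ` {-1..1})"
    by (intro compact_imp_bounded compact_continuous_image continuous_intros) auto
  then obtain B where B: "B > 0" "\<And>y. y \<in> {-1..1} \<Longrightarrow> \<bar>poly p y\<bar> \<le> B"
    by (auto simp: bounded_pos)
  have "\<bar>bump p m y\<bar> \<le> (4 * B * fact (m + 2)) * (y - x)\<^sup>2" if "1 \<le> \<bar>x\<bar>" for x y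
  proof (cases "\<bar>y\<bar> < 1")
    case True
    define u where "u = 1 - y\<^sup>2"
    have u: "0 < u" using True by (simp add: u_def abs_square_less_1)
    have "u = (1 - \<bar>y\<bar>) * (1 + \<bar>y\<bar>)" by (simp add: u_def algebra_simps power2_eq_square)
    \<comment> \<open>Since \<open>\<bar>x\<bar>\<close> is at least 1,
      \<open>1 - \<bar>y\<bar>\<close> is at most \<open>\<bar>x\<bar> - \<bar>y\<bar>\<close>,
      hence at most \<open>\<bar>y - x\<bar>\<close>.\<close>
    also have "\<dots> \<le> \<bar>y - x\<bar> * 2"
      using True that by (intro mult_mono) auto
    finally have "u\<^sup>2 \<le> (\<bar>y - x\<bar> * 2)\<^sup>2" using u by (intro power_mono) auto
    then have u2: "u\<^sup>2 \<le> 4 * (y - x)\<^sup>2" by (simp add: power_mult_distrib)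
    have "\<bar>bump p m y\<bar> = \<bar>poly p y\<bar> * (exp (- 1 / u) / u ^ m)"
      using True u by (simp add: bump_def u_def[symmetric] abs_mult)
    also have "\<dots> \<le> B * (fact (m + 2) * u\<^sup>2)"
      using True u B(1) by (intro mult_mono B(2) exp_neg_inverse_over_power_le) auto
    also have "\<dots> \<le> B * (fact (m + 2) * (4 * (y - x)\<^sup>2))"
      using B u2 by (intro mult_left_mono) auto
    finally show ?thesis by (simp add: mult_ac del: fact_Suc)
  qed (use B in \<open>simp add: bump_def\<close>)
  then show ?thesis using that by blast
qed

lemma has_real_derivative_0_quadratic:
  fixes f :: "real \<Rightarrow> real"
  assumes "\<And>y. \<bar>f y\<bar> \<le> C * (y - x)\<^sup>2"
  shows "(f has_real_derivative 0) (at x)"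
proof -
  have fx: "f x = 0" using assms[of x] by simp
  have "((\<lambda>y. C * \<bar>y - x\<bar>) \<longlongrightarrow> C * \<bar>x - x\<bar>) (at x)"
    by (intro tendsto_intros)
  then have "((\<lambda>y. (f y - f x) / (y - x)) \<longlongrightarrow> 0) (at x)"
  proof (rule Lim_null_comparison[rotated, OF tendsto_eq_rhs])
    show "\<forall>\<^sub>F y in at x. norm ((f y - f x) / (y - x)) \<le> C * \<bar>y - x\<bar>"
    proof (rule eventually_at_filter[THEN iffD2, OF always_eventually], intro allI impI)
      fix y assume "y \<noteq> x"
      have "\<bar>f y\<bar> \<le> C * (\<bar>y - x\<bar> * \<bar>y - x\<bar>)" using assms[of y] by (simp add: power2_eq_square)
      then show "norm ((f y - f x) / (y - x)) \<le> C * \<bar>y - x\<bar>"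
        using \<open>y \<noteq> x\<close> by (simp add: fx field_simps)
    qed
  qed simp
  then show ?thesis by (simp add: has_field_derivative_iff)
qed

text \<open>With \<open>u = 1 - x\<^sup>2\<close>, this is the numerator
  \<open>- 2 * x * p + p' * u\<^sup>2 + 2 * m * x * p * u\<close> that appears when the derivative
  of \<open>p * exp (- 1 / u) / u ^ m\<close> is put over \<open>u ^ (m + 2)\<close>.\<close>

definition bump_deriv_poly :: "real poly \<Rightarrow> nat \<Rightarrow> real poly" where
  "bump_deriv_poly p m = [:0, -2:] * p + pderiv p * [:1, 0, -1:]\<^sup>2
     + smult (2 * real m) ([:0, 1:] * p * [:1, 0, -1:])"

text \<open>Inside the interval this is the quotient rule. At all other points, 1 and -1 included,
  the quadratic bound forces the derivative 0, which is the value of every \<open>bump\<close>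
  there.\<close>

lemma bump_has_derivative:
  "(bump p m has_real_derivative bump (bump_deriv_poly p m) (m + 2) x) (at x)"
proof (cases "\<bar>x\<bar> < 1")
  case True
  define u where "u = 1 - x\<^sup>2"
  have u: "0 < u" using True by (simp add: u_def abs_square_less_1)
  have D: "((\<lambda>x. poly p x * exp (- 1 / (1 - x\<^sup>2)) / (1 - x\<^sup>2) ^ m) has_real_derivative
      (poly (pderiv p) x * exp (- 1 / u) + poly p x * (exp (- 1 / u) * (- (2 * x) / u\<^sup>2))) / u ^ m
       + poly p x * exp (- 1 / u) * (2 * real m * x / u ^ (m + 1))) (at x)"
  proof -
    have E: "((\<lambda>x. exp (- 1 / (1 - x\<^sup>2))) has_real_derivative
        exp (- 1 / u) * (- (2 * x) / u\<^sup>2)) (at x)"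
      using u unfolding u_def
      by (auto intro!: derivative_eq_intros simp: power2_eq_square)
    have P: "((\<lambda>x. (1 - x\<^sup>2) ^ m) has_real_derivative real m * u ^ (m - 1) * (- 2 * x)) (at x)"
      unfolding u_def by (auto intro!: derivative_eq_intros)
    have nz: "(1 - x\<^sup>2) ^ m \<noteq> 0" using u by (simp add: u_def)
    \<comment> \<open>The power rule produces \<open>u ^ (m - 1)\<close>; splitting on
      \<open>m\<close> resolves the truncated subtraction.\<close>
    show ?thesis
      by (rule DERIV_cong[OF DERIV_divide[OF DERIV_mult[OF poly_DERIV E] P nz]], cases m)
        (use u in \<open>simp_all add: u_def[symmetric] field_simps\<close>)
  qed
  have "bump (bump_deriv_poly p m) (m + 2) x =
     (poly (pderiv p) x * exp (- 1 / u) + poly p x * (exp (- 1 / u) * (- (2 * x) / u\<^sup>2))) / u ^ m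
       + poly p x * exp (- 1 / u) * (2 * real m * x / u ^ (m + 1))"
  proof -
    have "poly (bump_deriv_poly p m) x =
       - 2 * x * poly p x + poly (pderiv p) x * u\<^sup>2 + 2 * real m * (x * poly p x * u)"
      by (simp add: bump_deriv_poly_def u_def power2_eq_square algebra_simps)
    moreover have "bump q k x = poly q x * exp (- 1 / u) / u ^ k" for q k
      using True by (simp add: bump_def u_def)
    ultimately have "bump (bump_deriv_poly p m) (m + 2) x =
       (- 2 * x * poly p x + poly (pderiv p) x * u\<^sup>2 + 2 * real m * (x * poly p x * u))
         * exp (- 1 / u) / u ^ (m + 2)" by presburger
    then show ?thesis using u by (simp add: field_simps power2_eq_square)
  qed
  with D have D': "((\<lambda>x. poly p x * exp (- 1 / (1 - x\<^sup>2)) / (1 - x\<^sup>2) ^ m) has_real_derivative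
      bump (bump_deriv_poly p m) (m + 2) x) (at x)" by simp
  show ?thesis
    by (rule has_field_derivative_transform_within_open[OF D', of "{-1<..<1}"])
      (use True in \<open>auto simp: bump_def\<close>)
next
  case False
  obtain C where "\<And>x y. 1 \<le> \<bar>x\<bar> \<Longrightarrow> \<bar>bump p m y\<bar> \<le> C * (y - x)\<^sup>2"
    using bump_quadratic_bound[of p m] by blast
  then have "(bump p m has_real_derivative 0) (at x)"
    using False by (intro has_real_derivative_0_quadratic[of _ C]) auto
  then show ?thesis using False by (simp add: bump_def)
qed

lemma smooth_bump: "smooth (bump p m)"
proof (rule smooth_if_closed_under_deriv)
  show "g differentiable at t" if "g \<in> range (\<lambda>(p, m). bump p m)" for g t
    using that bump_has_derivative by (auto simp: real_differentiable_def)
  show "deriv g \<in> range (\<lambda>(p, m). bump p m)" if g: "g \<in> range (\<lambda>(p, m). bump p m)" for g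
  proof -
    obtain p m where "g = bump p m" using g by auto
    then have "deriv g = bump (bump_deriv_poly p m) (m + 2)"
      using bump_has_derivative by (auto intro!: DERIV_imp_deriv)
    then show ?thesis by auto
  qed
qed auto

text \<open>\<open>S\<close> is the normalised antiderivative of the standard bump, and
  \<open>\<rho>\<close> its density of total mass 1.\<close>

lemma smooth_transition_exists:
  obtains S \<rho> :: "real \<Rightarrow> real" where "smooth S"
    "\<And>x. (S has_real_derivative \<rho> x) (at x)" "\<And>x. 0 \<le> \<rho> x" "\<And>x. 1 \<le> \<bar>x\<bar> \<Longrightarrow> \<rho> x = 0"
    "\<And>x. x \<le> -1 \<Longrightarrow> S x = 0" "\<And>x. 1 \<le> x \<Longrightarrow> S x = 1"
proof -
  define r where "r = bump 1 0"
  have r0: "0 \<le> r x" and r1: "1 \<le> \<bar>x\<bar> \<Longrightarrow> r x = 0" for x by (auto simp: r_def bump_def)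
  have cont: "continuous_on A r" for A
    by (simp add: r_def smooth_bump smooth_continuous_on)
  \<comment> \<open>The interval from -2 to 2 strictly contains the support. With base point -2,
    points beyond -2 are interior for the fundamental theorem, and points up to -2 lie in the region
    where \<open>S\<close> is constantly 0.\<close>
  define J where "J = integral {-2..2} r"
  have "r 0 \<noteq> 0" by (simp add: r_def bump_def)
  then have "J \<noteq> 0" unfolding J_def
    using integral_eq_0_iff[of "-2" 2 r] cont r0 by (auto intro!: bexI[of _ 0])
  define S where "S x = integral {-2..x} r / J" for x
  define \<rho> where "\<rho> x = r x / J" for x
  have "J \<ge> 0" unfolding J_def by (intro integral_nonneg integrable_continuous_real cont r0)
  have S0: "S x = 0" if "x \<le> -1" for x
  proof -
    have "integral {-2..x} r = integral {-2..x} (\<lambda>_. 0)"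
      using that by (intro integral_cong r1) auto
    then show ?thesis by (simp add: S_def)
  qed
  have S1: "S x = 1" if "1 \<le> x" for x
  proof -
    have *: "integral {-2..x} r = integral {-2..1} r" if "1 \<le> x" for x
    proof -
      have "integral {1..x} r = integral {1..x} (\<lambda>_. 0)"
        using that by (intro integral_cong r1) auto
      then show ?thesis
        using Henstock_Kurzweil_Integration.integral_combine[of "-2" 1 x r] that
          integrable_continuous_real[OF cont] by auto
    qed
    show ?thesis using *[OF that] *[of 2] \<open>J \<noteq> 0\<close> by (simp add: S_def J_def)
  qed
  have D: "(S has_real_derivative \<rho> x) (at x)" for x
  proof (cases "-2 < x")
    case True
    have "((\<lambda>x. integral {-2..x} r) has_real_derivative r x) (at x within {-2..x+1})"
      using True by (intro integral_has_real_derivative cont) auto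
    then have "((\<lambda>x. integral {-2..x} r) has_real_derivative r x) (at x)"
      using True by (simp add: at_within_Icc_at)
    then show ?thesis unfolding S_def \<rho>_def by (rule DERIV_cdivide)
  next
    case False
    have "((\<lambda>_. 0) has_real_derivative \<rho> x) (at x)"
      using False by (simp add: \<rho>_def r1)
    then show ?thesis
      by (rule has_field_derivative_transform_within_open[of _ _ _ "{..<-1}"])
        (use False in \<open>auto simp: S0\<close>)
  qed
  have "smooth S"
  proof -
    \<comment> \<open>The zero summand only brings the derivative into the form of
      \<open>smooth_lincomb\<close>.\<close>
    have "deriv S = (\<lambda>x. (1 / J) * r x + 0 * r x)"
      using DERIV_imp_deriv[OF D] by (auto simp: \<rho>_def)
    then show ?thesis
      using D smooth_lincomb[OF smooth_bump smooth_bump]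
      by (metis r_def real_differentiable_def smooth_iff_deriv)
  qed
  then show ?thesis
    using that[of S \<rho>] D S0 S1 r0 r1 \<open>J \<ge> 0\<close> by (auto simp: \<rho>_def)
qed

subsection \<open>Primitives of distributional derivatives\<close>

lemma test_functions_iff:
  "\<phi> \<in> test_functions a b \<longleftrightarrow>
    smooth \<phi> \<and> compact (closure {t. \<phi> t \<noteq> 0}) \<and> closure {t. \<phi> t \<noteq> 0} \<subseteq> {a<..<b}"
  by (simp add: test_functions_def smooth_def)

lemma test_functionI:
  assumes "smooth \<phi>" "compact K" "K \<subseteq> {a<..<b}" "\<And>t. t \<notin> K \<Longrightarrow> \<phi> t = 0"
  shows "\<phi> \<in> test_functions a b"
proof -
  have "closure {t. \<phi> t \<noteq> 0} \<subseteq> K"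
    using assms by (intro closure_minimal compact_imp_closed) auto
  then show ?thesis
    unfolding test_functions_iff using assms
    by (metis (no_types, lifting) closed_closure compact_Int_closed inf.absorb_iff2 subset_trans)
qed

lemma test_functions_lincomb:
  assumes "\<phi> \<in> test_functions a b" "\<psi> \<in> test_functions a b"
  shows "(\<lambda>t. c * \<phi> t + d * \<psi> t) \<in> test_functions a b"
proof (rule test_functionI)
  show "smooth (\<lambda>t. c * \<phi> t + d * \<psi> t)"
    using assms by (auto simp: test_functions_iff intro: smooth_lincomb)
  let ?K = "closure {t. \<phi> t \<noteq> 0} \<union> closure {t. \<psi> t \<noteq> 0}"
  show "compact ?K" "?K \<subseteq> {a<..<b}"
    using assms by (auto simp: test_functions_iff)
  show "c * \<phi> t + d * \<psi> t = 0" if "t \<notin> ?K" for t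
  proof -
    have "\<phi> t = 0" "\<psi> t = 0"
      using that closure_subset[of "{t. \<phi> t \<noteq> 0}"] closure_subset[of "{t. \<psi> t \<noteq> 0}"] by auto
    then show ?thesis by simp
  qed
qed

lemma deriv_test_function:
  assumes "\<phi> \<in> test_functions a b"
  shows "deriv \<phi> \<in> test_functions a b"
proof (rule test_functionI)
  let ?K = "closure {t. \<phi> t \<noteq> 0}"
  show "smooth (deriv \<phi>)" "compact ?K" "?K \<subseteq> {a<..<b}"
    using assms by (auto simp: test_functions_iff smooth_deriv)
  show "deriv \<phi> t = 0" if "t \<notin> ?K" for t
  proof (rule DERIV_imp_deriv, rule has_field_derivative_transform_within_open)
    show "((\<lambda>_. 0) has_real_derivative 0) (at t)" by simp
    show "0 = \<phi> s" if "s \<in> - ?K" for s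
      using that closure_subset[of "{t. \<phi> t \<noteq> 0}"] by auto
  qed (use that in auto)
qed

lemma test_function_continuous_on:
  "\<phi> \<in> test_functions a b \<Longrightarrow> continuous_on A \<phi>"
  by (auto simp: test_functions_iff smooth_continuous_on)

lemma dist_deriv_dist_of:
  assumes "\<phi> \<in> test_functions a b"
  shows "dist_deriv a b (dist_of a b F) \<phi> = - integral {a..b} (\<lambda>t. F t * deriv \<phi> t)"
  using assms by (simp add: dist_deriv_def dist_of_def deriv_test_function)

text \<open>\<open>is_dist_primitive\<close> requires membership in \<open>distributions\<close>;
  this makes \<open>F\<close> itself a witness for the choice in
  \<open>dist_primitive\<close>.\<close>

lemma dist_deriv_dist_of_in_distributions:
  assumes F: "continuous_on {a..b} F"
  shows "dist_deriv a b (dist_of a b F) \<in> distributions a b"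
proof -
  let ?T = "dist_deriv a b (dist_of a b F)"
  have int: "(\<lambda>t. F t * deriv \<phi> t) integrable_on {a..b}" if "\<phi> \<in> test_functions a b" for \<phi>
    using test_function_continuous_on[OF deriv_test_function[OF that]]
    by (intro integrable_continuous_real continuous_intros F)
  have "?T \<in> extensional (test_functions a b)"
    by (simp add: dist_deriv_def)
  moreover have "?T (\<lambda>t. c * \<phi> t + d * \<psi> t) = c * ?T \<phi> + d * ?T \<psi>"
    if \<phi>: "\<phi> \<in> test_functions a b" and \<psi>: "\<psi> \<in> test_functions a b" for \<phi> \<psi> c d
  proof -
    have "deriv (\<lambda>t. c * \<phi> t + d * \<psi> t) = (\<lambda>t. c * deriv \<phi> t + d * deriv \<psi> t)"
      using \<phi> \<psi> deriv_funpow_lincomb[of \<phi> \<psi> 1 c d] by (simp add: test_functions_iff)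
    then have "?T (\<lambda>t. c * \<phi> t + d * \<psi> t)
        = - integral {a..b} (\<lambda>t. c * (F t * deriv \<phi> t) + d * (F t * deriv \<psi> t))"
      using dist_deriv_dist_of[OF test_functions_lincomb[OF \<phi> \<psi>]] by (simp add: algebra_simps)
    also have "integral {a..b} (\<lambda>t. c * (F t * deriv \<phi> t) + d * (F t * deriv \<psi> t))
        = c * integral {a..b} (\<lambda>t. F t * deriv \<phi> t) + d * integral {a..b} (\<lambda>t. F t * deriv \<psi> t)"
      using int[OF \<phi>] int[OF \<psi>]
      by (subst Henstock_Kurzweil_Integration.integral_add) (auto intro!: integrable_on_mult_right)
    finally show ?thesis using \<phi> \<psi> by (simp add: dist_deriv_dist_of)
  qed
  moreover have "(\<lambda>j. ?T (\<phi>s j)) \<longlonglongrightarrow> ?T \<phi>"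
    if \<phi>: "\<phi> \<in> test_functions a b" and \<phi>s: "\<And>j. \<phi>s j \<in> test_functions a b"
      and conv: "test_converges a b \<phi>s \<phi>" for \<phi>s \<phi>
  proof -
    \<comment> \<open>Uniform convergence of the first derivatives survives multiplication by the
      bounded \<open>F\<close>, and then passes to the integrals over \<open>{a..b}\<close>.\<close>
    have "uniform_limit UNIV (\<lambda>j. (deriv ^^ 1) (\<phi>s j)) ((deriv ^^ 1) \<phi>) sequentially"
      using conv unfolding test_converges_def by blast
    then have "uniform_limit {a..b} (\<lambda>j. deriv (\<phi>s j)) (deriv \<phi>) sequentially"
      by (auto intro: uniform_limit_on_subset)
    moreover have "bounded (F ` {a..b})" "bounded (deriv \<phi> ` {a..b})"
      using F test_function_continuous_on[OF deriv_test_function[OF \<phi>]]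
      by (auto intro!: compact_imp_bounded compact_continuous_image)
    ultimately have "uniform_limit {a..b} (\<lambda>j t. F t * deriv (\<phi>s j) t) (\<lambda>t. F t * deriv \<phi> t) sequentially"
      by (intro bounded_bilinear_bounded_uniform_limit_intros uniform_limit_const)
    then obtain I J where IJ: "\<And>j. ((\<lambda>t. F t * deriv (\<phi>s j) t) has_integral I j) {a..b}"
      "((\<lambda>t. F t * deriv \<phi> t) has_integral J) {a..b}" "I \<longlonglongrightarrow> J"
      using test_function_continuous_on[OF deriv_test_function[OF \<phi>s]]
      by (elim uniform_limit_integral) (auto intro!: continuous_intros F)
    then have "(\<lambda>j. integral {a..b} (\<lambda>t. F t * deriv (\<phi>s j) t)) \<longlonglongrightarrow> integral {a..b} (\<lambda>t. F t * deriv \<phi> t)"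
      using integral_unique[OF IJ(1)] integral_unique[OF IJ(2)] IJ(3) by simp
    then have "(\<lambda>j. - integral {a..b} (\<lambda>t. F t * deriv (\<phi>s j) t))
        \<longlonglongrightarrow> - integral {a..b} (\<lambda>t. F t * deriv \<phi> t)"
      by (rule tendsto_minus)
    then show ?thesis using \<phi> \<phi>s by (simp add: dist_deriv_dist_of)
  qed
  ultimately show ?thesis unfolding distributions_def by blast
qed

section \<open>The fundamental lemma of the calculus of variations\<close>

lemma du_Bois_Reymond:
  assumes G: "continuous_on {a..b} G"
    and orth: "\<And>\<phi>. \<phi> \<in> test_functions a b \<Longrightarrow> integral {a..b} (\<lambda>t. G t * deriv \<phi> t) = 0"
    and c: "c \<in> {a<..<b}" and d: "d \<in> {a<..<b}"
  shows "G c = G d"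
proof (rule ccontr)
  assume "G c \<noteq> G d"
  \<comment> \<open>A third, because two averages, each off by at most \<open>\<eta>\<close>, will
    be compared, and \<open>2 * \<eta> < 3 * \<eta>\<close>.\<close>
  define \<eta> where "\<eta> = \<bar>G c - G d\<bar> / 3"
  have "\<eta> > 0" using \<open>G c \<noteq> G d\<close> by (simp add: \<eta>_def)
  obtain S \<rho> :: "real \<Rightarrow> real" where S: "smooth S"
    "\<And>x. (S has_real_derivative \<rho> x) (at x)" "\<And>x. 0 \<le> \<rho> x" "\<And>x. 1 \<le> \<bar>x\<bar> \<Longrightarrow> \<rho> x = 0"
    "\<And>x. x \<le> -1 \<Longrightarrow> S x = 0" "\<And>x. 1 \<le> x \<Longrightarrow> S x = 1"
    using smooth_transition_exists by blast
  \<comment> \<open>Asserted for every smaller radius too, so that the minimum of the two radii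
    serves \<open>c\<close> and \<open>d\<close> simultaneously.\<close>
  have near: "\<exists>\<epsilon>0>0. \<forall>\<epsilon>. 0 < \<epsilon> \<and> \<epsilon> \<le> \<epsilon>0 \<longrightarrow> {p - \<epsilon>..p + \<epsilon>} \<subseteq> {a<..<b} \<and>
      (\<forall>t\<in>{p - \<epsilon>..p + \<epsilon>}. \<bar>G t - G p\<bar> \<le> \<eta>)" if p: "p \<in> {a<..<b}" for p
  proof -
    have "isCont G p"
      using G p by (metis at_within_interior box_real(1) box_real(2) continuous_on_eq_continuous_within
          interior_cbox greaterThanLessThan_subseteq_atLeastAtMost_iff subsetD order_refl)
    then obtain r where r: "r > 0" "\<And>t. \<bar>t - p\<bar> < r \<Longrightarrow> \<bar>G t - G p\<bar> < \<eta>"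
      using \<open>\<eta> > 0\<close> by (metis continuous_at_eps_delta dist_real_def)
    define \<epsilon>0 where "\<epsilon>0 = min (r / 2) (min (p - a) (b - p) / 2)"
    have "\<epsilon>0 > 0" using r p by (auto simp: \<epsilon>0_def)
    moreover have "{p - \<epsilon>..p + \<epsilon>} \<subseteq> {a<..<b} \<and> (\<forall>t\<in>{p - \<epsilon>..p + \<epsilon>}. \<bar>G t - G p\<bar> \<le> \<eta>)"
      if \<epsilon>: "0 < \<epsilon> \<and> \<epsilon> \<le> \<epsilon>0" for \<epsilon>
    proof -
      have "\<epsilon> < r" "a < p - \<epsilon>" "p + \<epsilon> < b"
        using \<epsilon> r p by (auto simp: \<epsilon>0_def)
      moreover have "\<bar>G t - G p\<bar> \<le> \<eta>" if "t \<in> {p - \<epsilon>..p + \<epsilon>}" for t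
        using r(2)[of t] that \<open>\<epsilon> < r\<close> 
        by (smt (verit) atLeastAtMost_iff)
      ultimately show ?thesis by auto
    qed
    ultimately show ?thesis by blast
  qed
  obtain \<epsilon> where \<epsilon>: "\<epsilon> > 0" and sub: "\<And>p. p = c \<or> p = d \<Longrightarrow> {p - \<epsilon>..p + \<epsilon>} \<subseteq> {a<..<b}"
    and close: "\<And>p t. p = c \<or> p = d \<Longrightarrow> t \<in> {p - \<epsilon>..p + \<epsilon>} \<Longrightarrow> \<bar>G t - G p\<bar> \<le> \<eta>"
  proof -
    obtain e1 e2 where e: "e1 > 0" "e2 > 0"
      "\<forall>\<epsilon>. 0 < \<epsilon> \<and> \<epsilon> \<le> e1 \<longrightarrow> {c - \<epsilon>..c + \<epsilon>} \<subseteq> {a<..<b} \<and> (\<forall>t\<in>{c - \<epsilon>..c + \<epsilon>}. \<bar>G t - G c\<bar> \<le> \<eta>)"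
      "\<forall>\<epsilon>. 0 < \<epsilon> \<and> \<epsilon> \<le> e2 \<longrightarrow> {d - \<epsilon>..d + \<epsilon>} \<subseteq> {a<..<b} \<and> (\<forall>t\<in>{d - \<epsilon>..d + \<epsilon>}. \<bar>G t - G d\<bar> \<le> \<eta>)"
      using near[OF c] near[OF d] by blast
    then have "0 < min e1 e2 \<and> min e1 e2 \<le> e1" "0 < min e1 e2 \<and> min e1 e2 \<le> e2" by auto
    with e(3,4) show ?thesis using that[of "min e1 e2"] by blast
  qed
  have inside: "a < p - \<epsilon>" "p + \<epsilon> < b" if "p = c \<or> p = d" for p
    using subsetD[OF sub[OF that], of "p - \<epsilon>"] subsetD[OF sub[OF that], of "p + \<epsilon>"] \<epsilon> by auto
  \<comment> \<open>The step rescaled to \<open>{p - \<epsilon>..p + \<epsilon>}\<close>. The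
    argument is \<open>(t - p) / \<epsilon>\<close>, written in the shape of
    \<open>smooth_affine\<close>.\<close>
  define S' where "S' p t = S (1 / \<epsilon> * t + - p / \<epsilon>)" for p t
  define \<rho>' where "\<rho>' p t = \<rho> (1 / \<epsilon> * t + - p / \<epsilon>) / \<epsilon>" for p t
  have DS': "(S' p has_real_derivative \<rho>' p t) (at t)" for p t
    unfolding S'_def \<rho>'_def
    by (rule DERIV_cong[OF DERIV_chain2[OF S(2)]]) (use \<epsilon> in \<open>auto intro!: derivative_eq_intros\<close>)
  have smS': "smooth (S' p)" for p
    unfolding S'_def by (rule smooth_affine[OF S(1)])
  have cont_\<rho>': "continuous_on A (\<rho>' p)" for A p
  proof -
    have "\<rho>' p = deriv (S' p)" by (rule ext) (rule DERIV_imp_deriv[OF DS', symmetric])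
    then show ?thesis by (simp add: smS' smooth_deriv smooth_continuous_on)
  qed
  have S'0: "S' p t = 0" if "t \<le> p - \<epsilon>" for p t
    unfolding S'_def using that \<epsilon> by (intro S(5)) (simp add: field_simps)
  have S'1: "S' p t = 1" if "p + \<epsilon> \<le> t" for p t
    unfolding S'_def using that \<epsilon> by (intro S(6)) (simp add: field_simps)
  have \<rho>'_nonneg: "0 \<le> \<rho>' p t" for p t
    unfolding \<rho>'_def using S(3) \<epsilon> by simp
  have \<rho>'0: "\<rho>' p t = 0" if "t \<notin> {p - \<epsilon>..p + \<epsilon>}" for p t
  proof -
    have "1 \<le> \<bar>(t - p) / \<epsilon>\<bar>" using that \<epsilon> by (auto simp: field_simps abs_if)
    then show ?thesis by (simp add: \<rho>'_def S(4) diff_divide_distrib)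
  qed
  \<comment> \<open>\<open>\<rho>' p\<close> is nonnegative, has integral 1 and vanishes off
    \<open>{p - \<epsilon>..p + \<epsilon>}\<close>, so the integral is a weighted mean of values of
    \<open>G\<close> near \<open>p\<close>.\<close>
  have avg: "\<bar>integral {a..b} (\<lambda>t. G t * \<rho>' p t) - G p\<bar> \<le> \<eta>" if p: "p = c \<or> p = d" for p
  proof -
    have "(\<rho>' p has_integral S' p b - S' p a) {a..b}"
    proof (rule fundamental_theorem_of_calculus)
      show "(S' p has_vector_derivative \<rho>' p t) (at t within {a..b})" for t
        using DS' by (metis has_real_derivative_iff_has_vector_derivative has_vector_derivative_at_within)
    qed (use inside[OF p] \<epsilon> in auto)
    then have one: "(\<rho>' p has_integral 1) {a..b}"
      using inside[OF p] by (simp add: S'0 S'1)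
    have "((\<lambda>t. G t * \<rho>' p t) has_integral integral {a..b} (\<lambda>t. G t * \<rho>' p t)) {a..b}"
      by (intro integrable_integral integrable_continuous_real continuous_intros G cont_\<rho>')
    then have diff: "((\<lambda>t. (G t - G p) * \<rho>' p t) has_integral
        integral {a..b} (\<lambda>t. G t * \<rho>' p t) - G p) {a..b}"
      using has_integral_diff[OF _ has_integral_mult_right[OF one, of "G p"]]
      by (simp add: left_diff_distrib)
    have bound: "norm ((G t - G p) * \<rho>' p t) \<le> \<eta> * \<rho>' p t" for t
      using close[OF p, of t] \<rho>'0[of t p] \<rho>'_nonneg[of p t]
      by (cases "t \<in> {p - \<epsilon>..p + \<epsilon>}") (auto simp: abs_mult intro!: mult_right_mono)
    show ?thesis
      using integral_norm_bound_integral[OF has_integral_integrable[OF diff]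
          has_integral_integrable[OF has_integral_mult_right[OF one, of \<eta>]] bound]
        integral_unique[OF diff] integral_unique[OF one]
      by simp
  qed
  \<comment> \<open>Neither step has compact support, but both are 0 to the left of the two windows
    and both are 1 to the right, so the difference has. The order of \<open>c\<close> and
    \<open>d\<close> does not matter.\<close>
  define \<phi> where "\<phi> t = 1 * S' c t + (- 1) * S' d t" for t
  have "\<phi> \<in> test_functions a b"
  proof (rule test_functionI)
    show "smooth \<phi>" unfolding \<phi>_def by (intro smooth_lincomb smS')
    show "{min c d - \<epsilon>..max c d + \<epsilon>} \<subseteq> {a<..<b}"
      using inside[of c] inside[of d] by auto
    show "\<phi> t = 0" if "t \<notin> {min c d - \<epsilon>..max c d + \<epsilon>}" for t
      using that by (cases "t \<le> min c d") (auto simp: \<phi>_def S'0 S'1)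
  qed auto
  then have "integral {a..b} (\<lambda>t. G t * deriv \<phi> t) = 0" by (rule orth)
  moreover have "deriv \<phi> = (\<lambda>t. \<rho>' c t - \<rho>' d t)"
    unfolding \<phi>_def by (intro ext DERIV_imp_deriv) (auto intro!: derivative_eq_intros DS')
  ultimately have "integral {a..b} (\<lambda>t. G t * \<rho>' c t - G t * \<rho>' d t) = 0"
    by (simp add: right_diff_distrib)
  then have "integral {a..b} (\<lambda>t. G t * \<rho>' c t) = integral {a..b} (\<lambda>t. G t * \<rho>' d t)"
    by (subst (asm) Henstock_Kurzweil_Integration.integral_diff)
      (auto intro!: integrable_continuous_real continuous_intros G cont_\<rho>')
  then have "\<bar>G c - G d\<bar> \<le> 2 * \<eta>"
    using avg[of c] avg[of d] by auto
  then show False using \<open>\<eta> > 0\<close> by (simp add: \<eta>_def)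
qed

text \<open>Everything that can be said about the chosen primitive. Continuity is delivered along
  with it, because the chosen function itself enters the Stieltjes sums.\<close>

lemma dist_primitive_dist_deriv:
  assumes "a < b" and F: "continuous_on {a..b} F"
  obtains C where "\<And>x. x \<in> {a..b} \<Longrightarrow> dist_primitive a b (dist_deriv a b (dist_of a b F)) x = F x + C"
    "continuous_on {a..b} (dist_primitive a b (dist_deriv a b (dist_of a b F)))"
proof -
  define H where "H = dist_primitive a b (dist_deriv a b (dist_of a b F))"
  have "is_dist_primitive a b (dist_deriv a b (dist_of a b F)) F"
    by (simp add: is_dist_primitive_def F dist_deriv_dist_of_in_distributions)
  then have "is_dist_primitive a b (dist_deriv a b (dist_of a b F)) H"
    unfolding H_def dist_primitive_def by (rule someI[of "is_dist_primitive a b (dist_deriv a b (dist_of a b F))"])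
  then have H: "continuous_on {a..b} H"
    and eq: "dist_deriv a b (dist_of a b F) = dist_deriv a b (dist_of a b H)"
    by (auto simp: is_dist_primitive_def)
  let ?G = "\<lambda>x. H x - F x"
  have G: "continuous_on {a..b} ?G" by (intro continuous_intros F H)
  have orth: "integral {a..b} (\<lambda>t. ?G t * deriv \<phi> t) = 0" if \<phi>: "\<phi> \<in> test_functions a b" for \<phi>
  proof -
    note [continuous_intros] = test_function_continuous_on[OF deriv_test_function[OF \<phi>]]
    have "integral {a..b} (\<lambda>t. H t * deriv \<phi> t) = integral {a..b} (\<lambda>t. F t * deriv \<phi> t)"
      using fun_cong[OF eq, of \<phi>] \<phi> by (simp add: dist_deriv_dist_of)
    then show ?thesis
      by (simp add: left_diff_distrib, subst Henstock_Kurzweil_Integration.integral_diff)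
        (auto intro!: integrable_continuous_real continuous_intros F H)
  qed
  \<comment> \<open>The midpoint is just an interior reference point. Constancy on the open interval
    extends to its closure by continuity, which settles the end points.\<close>
  have "?G x = ?G ((a + b) / 2)" if "x \<in> {a..b}" for x
  proof (rule continuous_constant_on_closure[where f = ?G and S = "{a<..<b}"])
    show "continuous_on (closure {a<..<b}) ?G" using G \<open>a < b\<close> by simp
    show "?G y = ?G ((a + b) / 2)" if "y \<in> {a<..<b}" for y
      using du_Bois_Reymond[OF G orth that] \<open>a < b\<close> by simp
  qed (use that \<open>a < b\<close> in auto)
  then have "H x = F x + ?G ((a + b) / 2)" if "x \<in> {a..b}" for x
    using that by (simp add: algebra_simps)
  then show ?thesis using that H unfolding H_def by blast
qed

lemma dist_of_cong:
  assumes "\<And>x. x \<in> {a..b} \<Longrightarrow> F x = G x"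
  shows "dist_of a b F = dist_of a b G"
  unfolding dist_of_def by (intro restrict_ext integral_cong) (simp add: assms)

subsection \<open>Stieltjes integrals\<close>

text \<open>A tag lies in its interval, which is therefore nonempty, so \<open>Inf\<close> and
  \<open>Sup\<close> really are the end points.\<close>

lemma tagged_division_of_realE:
  fixes c d :: real
  assumes "p tagged_division_of {c..d}" "(t, K) \<in> p"
  obtains u v where "K = {u..v}" "u \<le> t" "t \<le> v" "c \<le> u" "v \<le> d" "Inf K = u" "Sup K = v"
proof -
  obtain u v where K: "K = {u..v}" 
    using tagged_division_ofD(4)[OF assms] by auto
  have "u \<le> t" "t \<le> v" using tagged_division_ofD(2)[OF assms] K by auto
  moreover from this have "c \<le> u" "v \<le> d" using tagged_division_ofD(3)[OF assms] K by auto
  ultimately show ?thesis using that K by auto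
qed

lemma has_RS_integralE:
  assumes "has_RS_integral H g c d I" "\<epsilon> > 0"
  obtains \<delta> where "\<delta> > 0"
    "\<And>p. p tagged_division_of {c..d} \<Longrightarrow> (\<And>t K. (t, K) \<in> p \<Longrightarrow> Sup K - Inf K < \<delta>) \<Longrightarrow>
      \<bar>(\<Sum>(t, K)\<in>p. H t * (g (Sup K) - g (Inf K))) - I\<bar> < \<epsilon>"
proof -
  have "\<exists>\<delta>>0. \<forall>p. p tagged_division_of {c..d} \<longrightarrow> (\<forall>(t, K)\<in>p. Sup K - Inf K < \<delta>) \<longrightarrow>
      \<bar>(\<Sum>(t, K)\<in>p. H t * (g (Sup K) - g (Inf K))) - I\<bar> < \<epsilon>"
    using assms by (simp only: has_RS_integral_def)
  then show ?thesis using that by blast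
qed

text \<open>Tagged divisions of arbitrarily small mesh exist, so one common sum lies close to both
  candidates; without this \<open>THE\<close> in \<open>RS_integral\<close> could not be
  evaluated.\<close>

lemma has_RS_integral_unique:
  assumes "c \<le> d" "has_RS_integral H g c d I" "has_RS_integral H g c d J"
  shows "I = J"
proof (rule ccontr)
  assume "I \<noteq> J"
  define \<epsilon> where "\<epsilon> = \<bar>I - J\<bar> / 2"
  have "\<epsilon> > 0" using \<open>I \<noteq> J\<close> by (simp add: \<epsilon>_def)
  let ?s = "\<lambda>p. \<Sum>(t, K)\<in>p. H t * (g (Sup K) - g (Inf K))"
  obtain \<delta>1 where "\<delta>1 > 0" and 1: "\<And>p. p tagged_division_of {c..d} \<Longrightarrow>
      (\<And>t K. (t, K) \<in> p \<Longrightarrow> Sup K - Inf K < \<delta>1) \<Longrightarrow> \<bar>?s p - I\<bar> < \<epsilon>"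
    using has_RS_integralE[OF assms(2) \<open>\<epsilon> > 0\<close>] by blast
  obtain \<delta>2 where "\<delta>2 > 0" and 2: "\<And>p. p tagged_division_of {c..d} \<Longrightarrow>
      (\<And>t K. (t, K) \<in> p \<Longrightarrow> Sup K - Inf K < \<delta>2) \<Longrightarrow> \<bar>?s p - J\<bar> < \<epsilon>"
    using has_RS_integralE[OF assms(3) \<open>\<epsilon> > 0\<close>] by blast
  define \<delta> where "\<delta> = min \<delta>1 \<delta>2"
  have "\<delta> > 0" using \<open>\<delta>1 > 0\<close> \<open>\<delta>2 > 0\<close> by (simp add: \<delta>_def)
  \<comment> \<open>A constant gauge turns fineness into small mesh: two points of an open ball of
    radius \<open>\<delta> / 2\<close> are less than \<open>\<delta>\<close> apart.\<close>
  then have "gauge (\<lambda>t::real. ball t (\<delta> / 2))" by (intro gauge_ball) simp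
  then obtain p where p: "p tagged_division_of {c..d}" "(\<lambda>t. ball t (\<delta> / 2)) fine p"
    using fine_division_exists_real by blast
  have mesh: "Sup K - Inf K < \<delta>" if tK: "(t, K) \<in> p" for t K
  proof -
    from p(1) tK obtain u v where K: "K = {u..v}" "u \<le> t" "t \<le> v" "c \<le> u" "v \<le> d" "Inf K = u" "Sup K = v"
      by (rule tagged_division_of_realE)
    then have "u \<in> ball t (\<delta> / 2)" "v \<in> ball t (\<delta> / 2)"
      using fineD[OF p(2) tK] K(1-3) by (auto simp del: mem_ball)
    then show ?thesis using K by (simp add: dist_real_def abs_if split: if_splits)
  qed
  have "\<bar>?s p - I\<bar> < \<epsilon>"
    by (rule 1[OF p(1)]) (use mesh in \<open>auto simp: \<delta>_def\<close>)
  moreover have "\<bar>?s p - J\<bar> < \<epsilon>"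
    by (rule 2[OF p(1)]) (use mesh in \<open>auto simp: \<delta>_def\<close>)
  moreover have "\<bar>I - J\<bar> = 2 * \<epsilon>" by (simp add: \<epsilon>_def)
  ultimately show False by linarith
qed

lemma RS_integral_eq:
  assumes "c \<le> d" "has_RS_integral H g c d I"
  shows "RS_integral H g c d = I"
  unfolding RS_integral_def using assms has_RS_integral_unique by blast

text \<open>On each piece the fundamental theorem rewrites \<open>H t * (g v - g u)\<close> as the
  integral of \<open>H t * g' s\<close>. Replacing \<open>H t\<close> by \<open>H s\<close> costs at
  most \<open>\<eta> * M\<close> times the length, by uniform continuity of
  \<open>H\<close>.\<close>

lemma has_RS_integral_C1:
  assumes "c \<le> d" and H: "continuous_on {c..d} H" and g': "continuous_on {c..d} g'"
    and g: "\<And>t. t \<in> {c..d} \<Longrightarrow> (g has_real_derivative g' t) (at t within {c..d})"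
  shows "has_RS_integral H g c d (integral {c..d} (\<lambda>t. H t * g' t))"
  unfolding has_RS_integral_def
proof (intro allI impI)
  fix \<epsilon> :: real assume "\<epsilon> > 0"
  have "bounded (g' ` {c..d})"
    by (intro compact_imp_bounded compact_continuous_image g') auto
  then obtain M where M: "M > 0" "\<And>t. t \<in> {c..d} \<Longrightarrow> \<bar>g' t\<bar> \<le> M"
    unfolding bounded_pos by auto
  \<comment> \<open>The total error will be \<open>\<eta> * M * (d - c)\<close>; the added 1 makes
    it strictly less than \<open>\<epsilon>\<close> and keeps the denominator positive when
    \<open>c = d\<close>.\<close>
  define \<eta> where "\<eta> = \<epsilon> / (M * (d - c) + 1)"
  have pos: "M * (d - c) + 1 > 0" using M \<open>c \<le> d\<close> by (simp add: add_nonneg_pos)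
  have "\<eta> > 0" using \<open>\<epsilon> > 0\<close> pos by (simp add: \<eta>_def)
  have "uniformly_continuous_on {c..d} H"
    using H by (intro compact_uniformly_continuous) auto
  then obtain \<delta> where "\<delta> > 0"
    and \<delta>: "\<And>s t. s \<in> {c..d} \<Longrightarrow> t \<in> {c..d} \<Longrightarrow> \<bar>s - t\<bar> < \<delta> \<Longrightarrow> \<bar>H s - H t\<bar> < \<eta>"
    using \<open>\<eta> > 0\<close> unfolding uniformly_continuous_on_def dist_real_def by metis
  have "\<bar>(\<Sum>(t, K)\<in>p. H t * (g (Sup K) - g (Inf K))) - integral {c..d} (\<lambda>t. H t * g' t)\<bar> < \<epsilon>"
    if p: "p tagged_division_of {c..d}" and mesh: "\<forall>(t, K)\<in>p. Sup K - Inf K < \<delta>" for p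
  proof -
    have summand: "\<bar>H t * (g (Sup K) - g (Inf K)) - integral K (\<lambda>s. H s * g' s)\<bar> \<le> \<eta> * M * measure lborel K"
      if tK: "(t, K) \<in> p" for t K
    proof -
      from p tK obtain u v where K: "K = {u..v}" "u \<le> t" "t \<le> v" "c \<le> u" "v \<le> d" "Inf K = u" "Sup K = v"
        by (rule tagged_division_of_realE)
      then have "v - u < \<delta>" using mesh tK by auto
      have sub: "{u..v} \<subseteq> {c..d}" using K by auto
      have "(g' has_integral g v - g u) {u..v}"
      proof (rule fundamental_theorem_of_calculus)
        show "(g has_vector_derivative g' s) (at s within {u..v})" if "s \<in> {u..v}" for s
          using g[of s] that sub
          by (metis DERIV_subset has_real_derivative_iff_has_vector_derivative subsetD)
      qed (use K in auto)
      then have "((\<lambda>s. H t * g' s) has_integral H t * (g v - g u)) {u..v}"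
        by (rule has_integral_mult_right)
      moreover have "((\<lambda>s. H s * g' s) has_integral integral {u..v} (\<lambda>s. H s * g' s)) {u..v}"
        using continuous_on_subset[OF H sub] continuous_on_subset[OF g' sub]
        by (intro integrable_integral integrable_continuous_real continuous_intros)
      ultimately have "((\<lambda>s. (H t - H s) * g' s) has_integral
          H t * (g v - g u) - integral {u..v} (\<lambda>s. H s * g' s)) {u..v}"
        by (simp add: left_diff_distrib has_integral_diff)
      then have "norm (H t * (g v - g u) - integral {u..v} (\<lambda>s. H s * g' s)) \<le> \<eta> * M * measure lborel {u..v}"
      proof (rule has_integral_bound_real[rotated 2])
        show "norm ((H t - H s) * g' s) \<le> \<eta> * M" if "s \<in> {u..v} - {}" for s
        proof -
          have "\<bar>H t - H s\<bar> < \<eta>" using that K \<open>v - u < \<delta>\<close> by (intro \<delta>) auto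
          moreover have "\<bar>g' s\<bar> \<le> M" using that sub by (intro M) auto
          ultimately show ?thesis
            unfolding real_norm_def abs_mult using M \<open>\<eta> > 0\<close> by (intro mult_mono) auto
        qed
      qed (use \<open>\<eta> > 0\<close> M in auto)
      then show ?thesis using K by simp
    qed
    have "integral {c..d} (\<lambda>t. H t * g' t) = (\<Sum>(t, K)\<in>p. integral K (\<lambda>s. H s * g' s))"
      using integral_combine_tagged_division_topdown[of "\<lambda>t. H t * g' t" c d p] p
      by (auto intro!: integrable_continuous_real continuous_intros H g')
    then have "\<bar>(\<Sum>(t, K)\<in>p. H t * (g (Sup K) - g (Inf K))) - integral {c..d} (\<lambda>t. H t * g' t)\<bar>
        = \<bar>\<Sum>(t, K)\<in>p. H t * (g (Sup K) - g (Inf K)) - integral K (\<lambda>s. H s * g' s)\<bar>"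
      by (simp add: sum_subtractf[symmetric] case_prod_unfold)
    also have "\<dots> \<le> (\<Sum>(t, K)\<in>p. \<eta> * M * measure lborel K)"
      by (rule order_trans[OF sum_abs sum_mono]) (use summand in auto)
    also have "\<dots> = \<eta> * M * (d - c)"
      using additive_content_tagged_division[of p c d] p \<open>c \<le> d\<close>
      by (simp add: sum_distrib_left[symmetric] case_prod_unfold)
    also have "\<dots> < \<eta> * (M * (d - c) + 1)" using \<open>\<eta> > 0\<close> by (simp add: algebra_simps)
    also have "\<dots> = \<epsilon>" using pos by (simp add: \<eta>_def)
    finally show ?thesis .
  qed
  then show "\<exists>\<delta>>0. \<forall>p. p tagged_division_of {c..d} \<longrightarrow> (\<forall>(t, K)\<in>p. Sup K - Inf K < \<delta>) \<longrightarrow>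
      \<bar>(\<Sum>(t, K)\<in>p. H t * (g (Sup K) - g (Inf K))) - integral {c..d} (\<lambda>t. H t * g' t)\<bar> < \<epsilon>"
    using \<open>\<delta> > 0\<close> by blast
qed

text \<open>Covers the indicator of \<open>{a..x}\<close> on intervals ending no later than
  \<open>x\<close>. Each summand vanishes, so any mesh bound will do.\<close>

lemma has_RS_integral_const:
  assumes "\<And>t. t \<in> {c..d} \<Longrightarrow> g t = k"
  shows "has_RS_integral H g c d 0"
  unfolding has_RS_integral_def
proof (intro allI impI exI[of _ 1] conjI)
  fix \<epsilon> :: real and p assume "\<epsilon> > 0" and p: "p tagged_division_of {c..d}"
  have "(\<Sum>(t, K)\<in>p. H t * (g (Sup K) - g (Inf K))) = 0"
  proof (rule sum.neutral, clarify)
    fix t K assume "(t, K) \<in> p"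
    with p obtain u v where "K = {u..v}" "u \<le> t" "t \<le> v" "c \<le> u" "v \<le> d" "Inf K = u" "Sup K = v"
      by (rule tagged_division_of_realE)
    then show "H t * (g (Sup K) - g (Inf K)) = 0" using assms by auto
  qed
  then show "\<bar>(\<Sum>(t, K)\<in>p. H t * (g (Sup K) - g (Inf K))) - 0\<bar> < \<epsilon>" using \<open>\<epsilon> > 0\<close> by simp
qed auto

text \<open>The indicator drops from 1 to 0 just after \<open>x\<close>. There is no need to locate
  the piece that contains the drop: all increments are nonpositive and sum to -1, and where one is
  nonzero the tag is near \<open>x\<close>, so the errors add up to at most
  \<open>\<epsilon> / 2\<close>.\<close>

lemma has_RS_integral_indicator:
  assumes H: "continuous_on {c..d} H" and x: "c \<le> x" "x < d"
  shows "has_RS_integral H (indicator {c..x}) c d (- H x)"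
  unfolding has_RS_integral_def
proof (intro allI impI)
  fix \<epsilon> :: real assume "\<epsilon> > 0"
  let ?g = "indicator {c..x} :: real \<Rightarrow> real"
  from \<open>\<epsilon> > 0\<close> H x obtain \<delta> where "\<delta> > 0"
    and \<delta>: "\<And>t. t \<in> {c..d} \<Longrightarrow> \<bar>t - x\<bar> < \<delta> \<Longrightarrow> \<bar>H t - H x\<bar> < \<epsilon> / 2"
    unfolding continuous_on_iff dist_real_def by (metis atLeastAtMost_iff half_gt_zero less_imp_le)
  have "\<bar>(\<Sum>(t, K)\<in>p. H t * (?g (Sup K) - ?g (Inf K))) - - H x\<bar> < \<epsilon>"
    if p: "p tagged_division_of {c..d}" and mesh: "\<forall>(t, K)\<in>p. Sup K - Inf K < \<delta>" for p
  proof -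
    have jump: "(\<Sum>(t, K)\<in>p. ?g (Sup K) - ?g (Inf K)) = - 1"
      using additive_tagged_division_1[OF _ p, of ?g] x by simp
    have summand: "\<bar>(H t - H x) * (?g (Sup K) - ?g (Inf K))\<bar> \<le> - (\<epsilon> / 2) * (?g (Sup K) - ?g (Inf K))"
      if tK: "(t, K) \<in> p" for t K
    proof -
      from p tK obtain u v where K: "K = {u..v}" "u \<le> t" "t \<le> v" "c \<le> u" "v \<le> d" "Inf K = u" "Sup K = v"
        by (rule tagged_division_of_realE)
      show ?thesis
      proof (cases "u \<le> x \<and> x < v")
        case True
        have "v - u < \<delta>" using mesh tK K by auto
        then have "\<bar>H t - H x\<bar> < \<epsilon> / 2" using K True by (intro \<delta>) auto
        then show ?thesis using K True by (simp add: indicator_def abs_minus_commute)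
      next
        case False
        then have "?g v = ?g u" using K by (auto simp: indicator_def)
        then show ?thesis using K by simp
      qed
    qed
    have "(\<Sum>(t, K)\<in>p. H t * (?g (Sup K) - ?g (Inf K))) - - H x
        = (\<Sum>(t, K)\<in>p. (H t - H x) * (?g (Sup K) - ?g (Inf K)))"
      using jump by (simp add: case_prod_unfold left_diff_distrib sum_subtractf sum_distrib_left[symmetric])
    also have "\<bar>\<dots>\<bar> \<le> (\<Sum>(t, K)\<in>p. - (\<epsilon> / 2) * (?g (Sup K) - ?g (Inf K)))"
      by (rule order_trans[OF sum_abs sum_mono]) (use summand in auto)
    also have "\<dots> = - (\<epsilon> / 2) * (\<Sum>(t, K)\<in>p. ?g (Sup K) - ?g (Inf K))"
      by (simp only: case_prod_unfold sum_distrib_left)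
    also have "\<dots> < \<epsilon>" using jump \<open>\<epsilon> > 0\<close> by simp
    finally show ?thesis .
  qed
  then show "\<exists>\<delta>>0. \<forall>p. p tagged_division_of {c..d} \<longrightarrow> (\<forall>(t, K)\<in>p. Sup K - Inf K < \<delta>) \<longrightarrow>
      \<bar>(\<Sum>(t, K)\<in>p. H t * (?g (Sup K) - ?g (Inf K))) - - H x\<bar> < \<epsilon>"
    using \<open>\<delta> > 0\<close> by blast
qed

section \<open>Integrals of a distributional derivative against a multiplier\<close>

lemma dist_integral_mult_C1:
  assumes "a < b" and F: "continuous_on {a..b} F" and y: "y \<in> {a..b}"
    and g': "continuous_on {a..y} g'"
    and g: "\<And>t. t \<in> {a..y} \<Longrightarrow> (g has_real_derivative g' t) (at t within {a..y})"
  shows "dist_integral_mult a b (dist_deriv a b (dist_of a b F)) g a y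
    = (F y - F a) * g y - integral {a..y} (\<lambda>t. (F t - F a) * g' t)"
proof -
  define H where "H = dist_primitive a b (dist_deriv a b (dist_of a b F))"
  obtain C where HF: "\<And>x. x \<in> {a..b} \<Longrightarrow> H x = F x + C" and H: "continuous_on {a..b} H"
    using dist_primitive_dist_deriv[OF \<open>a < b\<close> F] unfolding H_def by blast
  have sub: "{a..y} \<subseteq> {a..b}" and "a \<le> y" using y by auto
  have "(g' has_integral g y - g a) {a..y}"
    using g \<open>a \<le> y\<close> by (intro fundamental_theorem_of_calculus)
      (auto simp: has_real_derivative_iff_has_vector_derivative)
  \<comment> \<open>The share of the constant \<open>F a + C\<close> in the Stieltjes integral of
    \<open>H = F + C\<close>. It cancels against the boundary terms and takes the unknown
    \<open>C\<close> with it.\<close>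
  then have G: "((\<lambda>t. (F a + C) * g' t) has_integral (F a + C) * (g y - g a)) {a..y}"
    by (rule has_integral_mult_right)
  have "((\<lambda>t. (F t - F a) * g' t) has_integral integral {a..y} (\<lambda>t. (F t - F a) * g' t)) {a..y}"
    by (intro integrable_integral integrable_continuous_real continuous_intros
        continuous_on_subset[OF F sub] g')
  from has_integral_add[OF this G]
  have "((\<lambda>t. (F t + C) * g' t) has_integral
      integral {a..y} (\<lambda>t. (F t - F a) * g' t) + (F a + C) * (g y - g a)) {a..y}"
    by (simp add: algebra_simps)
  then have "integral {a..y} (\<lambda>t. H t * g' t)
      = integral {a..y} (\<lambda>t. (F t - F a) * g' t) + (F a + C) * (g y - g a)"
    using HF sub by (intro integral_unique) (auto elim!: has_integral_eq[rotated])
  then have "RS_integral H g a y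
      = integral {a..y} (\<lambda>t. (F t - F a) * g' t) + (F a + C) * (g y - g a)"
    using RS_integral_eq[OF \<open>a \<le> y\<close> has_RS_integral_C1[OF \<open>a \<le> y\<close> continuous_on_subset[OF H sub] g' g]]
    by simp
  then show ?thesis
    using HF[of a] HF[of y] y \<open>a < b\<close>
    by (simp add: dist_integral_mult_def H_def[symmetric] algebra_simps)
qed

text \<open>Up to \<open>x\<close> the integrator is constant and the boundary terms give the plain
  increment. Beyond \<open>x\<close> the boundary term at \<open>y\<close> is 0 and the jump
  contributes \<open>H x\<close>, so the indefinite integral stays frozen.\<close>

lemma dist_integral_mult_indicator:
  assumes "a < b" and F: "continuous_on {a..b} F" and x: "x \<in> {a..b}" and y: "y \<in> {a..b}"
  shows "dist_integral_mult a b (dist_deriv a b (dist_of a b F)) (indicator {a..x}) a y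
    = F (min y x) - F a"
proof -
  define H where "H = dist_primitive a b (dist_deriv a b (dist_of a b F))"
  obtain C where HF: "\<And>x. x \<in> {a..b} \<Longrightarrow> H x = F x + C" and H: "continuous_on {a..b} H"
    using dist_primitive_dist_deriv[OF \<open>a < b\<close> F] unfolding H_def by blast
  have sub: "{a..y} \<subseteq> {a..b}" and "a \<le> y" using y by auto
  have "RS_integral H (indicator {a..x}) a y = (if y \<le> x then 0 else - H x)"
  proof (cases "y \<le> x")
    case True
    then have "has_RS_integral H (indicator {a..x}) a y 0"
      by (intro has_RS_integral_const[of _ _ _ 1]) auto
    then show ?thesis using RS_integral_eq[OF \<open>a \<le> y\<close>] True by simp
  next
    case False
    then have "has_RS_integral H (indicator {a..x}) a y (- H x)"
      using x by (intro has_RS_integral_indicator continuous_on_subset[OF H sub]) auto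
    then show ?thesis using RS_integral_eq[OF \<open>a \<le> y\<close>] False by simp
  qed
  then show ?thesis
    using HF[of a] HF[of y] HF[of x] x y \<open>a < b\<close>
    by (simp add: dist_integral_mult_def H_def[symmetric] indicator_def min_def)
qed

text \<open>The boundary term is at most \<open>M * g y\<close> and the integral at most
  \<open>M * (g a - g y)\<close>, since \<open>\<bar>g' t\<bar> = - g' t\<close>. The sum telescopes
  to \<open>M * g a\<close>, which for \<open>(x - t) ^ n\<close> yields the factor
  \<open>(x - a) ^ n\<close>.\<close>

lemma abs_dist_integral_mult_le:
  assumes "a < b" and F: "continuous_on {a..b} F" and y: "y \<in> {a..b}"
    and g': "continuous_on {a..y} g'"
    and g: "\<And>t. t \<in> {a..y} \<Longrightarrow> (g has_real_derivative g' t) (at t within {a..y})"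
    and mono: "\<And>t. t \<in> {a..y} \<Longrightarrow> g' t \<le> 0" and "0 \<le> g y"
    and M: "\<And>t. t \<in> {a..y} \<Longrightarrow> \<bar>F t - F a\<bar> \<le> M"
  shows "\<bar>dist_integral_mult a b (dist_deriv a b (dist_of a b F)) g a y\<bar> \<le> M * g a"
proof -
  have sub: "{a..y} \<subseteq> {a..b}" and "a \<le> y" using y by auto
  have "(g' has_integral g y - g a) {a..y}"
    using g \<open>a \<le> y\<close> by (intro fundamental_theorem_of_calculus)
      (auto simp: has_real_derivative_iff_has_vector_derivative)
  then have G: "((\<lambda>t. - M * g' t) has_integral - M * (g y - g a)) {a..y}"
    by (rule has_integral_mult_right)
  have "norm (integral {a..y} (\<lambda>t. (F t - F a) * g' t)) \<le> integral {a..y} (\<lambda>t. - M * g' t)"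
  proof (rule integral_norm_bound_integral)
    show "(\<lambda>t. (F t - F a) * g' t) integrable_on {a..y}"
      by (intro integrable_continuous_real continuous_intros continuous_on_subset[OF F sub] g')
    show "(\<lambda>t. - M * g' t) integrable_on {a..y}" using G by (rule has_integral_integrable)
    show "norm ((F t - F a) * g' t) \<le> - M * g' t" if "t \<in> {a..y}" for t
      using mult_right_mono[OF M[OF that], of "\<bar>g' t\<bar>"] mono[OF that] by (simp add: abs_mult)
  qed
  also have "\<dots> = M * g a - M * g y"
    using integral_unique[OF G] by (simp add: algebra_simps)
  finally have "\<bar>integral {a..y} (\<lambda>t. (F t - F a) * g' t)\<bar> \<le> M * g a - M * g y" by simp
  moreover have "\<bar>(F y - F a) * g y\<bar> \<le> M * g y"
    using mult_right_mono[OF M[of y] \<open>0 \<le> g y\<close>] \<open>0 \<le> g y\<close> \<open>a \<le> y\<close> by (simp add: abs_mult)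
  moreover have "dist_integral_mult a b (dist_deriv a b (dist_of a b F)) g a y
      = (F y - F a) * g y - integral {a..y} (\<lambda>t. (F t - F a) * g' t)"
    by (rule dist_integral_mult_C1[OF \<open>a < b\<close> F y g' g])
  ultimately show ?thesis by linarith
qed

subsection \<open>The Alexiewicz norm\<close>

lemma max_on_eqI:
  assumes "x \<in> S" "F x = m" "\<And>y. y \<in> S \<Longrightarrow> F y \<le> m"
  shows "max_on S F = m"
  unfolding max_on_def using assms by (intro Greatest_equality) auto

lemma max_on_attained:
  assumes "compact S" "S \<noteq> {}" "continuous_on S F"
  obtains x where "x \<in> S" "max_on S F = F x" "\<And>y. y \<in> S \<Longrightarrow> F y \<le> max_on S F"
proof -
  obtain x where x: "x \<in> S" "\<And>y. y \<in> S \<Longrightarrow> F y \<le> F x"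
    using continuous_attains_sup[OF assms] by blast
  then have "max_on S F = F x" by (intro max_on_eqI) auto
  with x that show ?thesis by auto
qed

text \<open>The maximum depends only on the set of values, so the index set may change from
  \<open>{a..b}\<close> to \<open>{a..x}\<close>.\<close>

lemma max_on_cong_image: "F ` S = G ` T \<Longrightarrow> max_on S F = max_on T G"
  by (simp add: max_on_def)

lemma alexiewicz_norm_dist_deriv:
  assumes "a < b" and F: "continuous_on {a..b} F"
  shows "alexiewicz_norm a b (dist_deriv a b (dist_of a b F)) = max_on {a..b} (\<lambda>\<xi>. \<bar>F \<xi> - F a\<bar>)"
proof -
  obtain C where "\<And>x. x \<in> {a..b} \<Longrightarrow> dist_primitive a b (dist_deriv a b (dist_of a b F)) x = F x + C"
    using dist_primitive_dist_deriv[OF assms] by blast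
  then show ?thesis
    unfolding alexiewicz_norm_def dist_integral_def using \<open>a < b\<close>
    by (intro max_on_cong_image image_cong) auto
qed

text \<open>The truncated distribution is the derivative of the continuous function that follows
  \<open>F\<close> up to \<open>x\<close> and stays constant afterwards. Since
  \<open>min \<xi> x\<close> maps \<open>{a..b}\<close> onto \<open>{a..x}\<close>, its increments
  are those of \<open>F\<close> on \<open>{a..x}\<close>.\<close>

lemma alexiewicz_norm_restriction:
  assumes "a < b" and F: "continuous_on {a..b} F" and x: "x \<in> {a..b}"
  shows "alexiewicz_norm a b (dist_mult a b (dist_deriv a b (dist_of a b F)) (indicator {a..x}))
    = max_on {a..x} (\<lambda>\<xi>. \<bar>F \<xi> - F a\<bar>)"
proof -
  let ?G = "\<lambda>y. F (min y x) - F a"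
  have "dist_mult a b (dist_deriv a b (dist_of a b F)) (indicator {a..x})
      = dist_deriv a b (dist_of a b ?G)"
    unfolding dist_mult_def
    using dist_integral_mult_indicator[OF assms] by (subst dist_of_cong) auto
  moreover have "continuous_on {a..b} ?G"
    by (intro continuous_intros continuous_on_compose2[OF F]) (use x in auto)
  ultimately have "alexiewicz_norm a b (dist_mult a b (dist_deriv a b (dist_of a b F)) (indicator {a..x}))
      = max_on {a..b} (\<lambda>\<xi>. \<bar>?G \<xi> - ?G a\<bar>)"
    using alexiewicz_norm_dist_deriv[OF \<open>a < b\<close>] by simp
  also have "\<dots> = max_on {a..x} (\<lambda>\<xi>. \<bar>F \<xi> - F a\<bar>)"
  proof (rule max_on_cong_image)
    have "{a..x} = (\<lambda>\<xi>. min \<xi> x) ` {a..b}"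
      using x by (force simp: image_iff min_def)
    then show "(\<lambda>\<xi>. \<bar>?G \<xi> - ?G a\<bar>) ` {a..b} = (\<lambda>\<xi>. \<bar>F \<xi> - F a\<bar>) ` {a..x}"
      using x by (simp add: image_image)
  qed
  finally show ?thesis .
qed

subsection \<open>The remainder\<close>

lemma nth_deriv_has_vector_derivative:
  assumes "nth_deriv_continuous a b n f" "k < n" "t \<in> {a..b}"
  shows "(nth_deriv a b k f has_vector_derivative nth_deriv a b (Suc k) f t) (at t within {a..b})"
  using assms unfolding nth_deriv_continuous_def
  by (auto simp: nth_deriv_def vector_derivative_works)

lemma nth_deriv_continuous_imp_continuous_on:
  assumes "nth_deriv_continuous a b n f"
  shows "continuous_on {a..b} f"
proof (cases n)
  case 0
  then show ?thesis using assms by (simp add: nth_deriv_continuous_def nth_deriv_def)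
next
  case (Suc m)
  then show ?thesis
    using nth_deriv_has_vector_derivative[OF assms, of 0]
    by (intro continuous_on_vector_derivative) (auto simp: nth_deriv_def)
qed

text \<open>At \<open>n = 0\<close> the factor \<open>real n\<close> makes the derivative 0 whatever
  the truncated exponent \<open>n - 1\<close> is, so one formula serves all
  \<open>n\<close>.\<close>

lemma power_diff_has_derivative:
  "((\<lambda>t. (x - t) ^ n) has_real_derivative - (real n * (x - t) ^ (n - 1))) (at t within A)" for x t :: real
  by (auto intro!: derivative_eq_intros)

lemma taylor_remainder_formula:
  assumes "a < b" and f: "nth_deriv_continuous a b n f" and x: "x \<in> {a..b}"
  shows "f x = taylor_poly a b n f x + taylor_remainder a b n f x"
proof -
  let ?F = "nth_deriv a b n f"
  have F: "continuous_on {a..b} ?F" using f by (simp add: nth_deriv_continuous_def)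
  have sub: "{a..x} \<subseteq> {a..b}" and "a \<le> x" using x by auto
  note Fx = continuous_on_subset[OF F sub]
  have R: "taylor_remainder a b n f x = 1 / fact n * ((?F x - ?F a) * (x - x) ^ n
      - integral {a..x} (\<lambda>t. (?F t - ?F a) * - (real n * (x - t) ^ (n - 1))))"
    unfolding taylor_remainder_def dist_deriv_Suc_def
    by (subst dist_integral_mult_C1[OF \<open>a < b\<close> F x _ power_diff_has_derivative])
      (auto intro!: continuous_intros)
  show ?thesis
  proof (cases n)
    case 0
    then show ?thesis using R by (simp add: taylor_poly_def nth_deriv_def)
  next
    case (Suc m)
    \<comment> \<open>The classical formula uses \<open>n\<close> derivatives, with the polynomial
      ending at \<open>n - 1\<close>; it needs \<open>n\<close> positive, hence the case
      split.\<close>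
    have "((\<lambda>t. ((x - t) ^ (n - 1) / fact (n - 1)) *\<^sub>R ?F t) has_integral
        f x - (\<Sum>i<n. ((x - a) ^ i / fact i) *\<^sub>R nth_deriv a b i f a)) {a..x}"
    proof (rule Taylor_has_integral)
      show "(nth_deriv a b k f has_vector_derivative nth_deriv a b (Suc k) f t) (at t within {a..x})"
        if "k < n" "a \<le> t" "t \<le> x" for k t
        using nth_deriv_has_vector_derivative[OF f \<open>k < n\<close>, of t] that sub
        by (auto intro: has_vector_derivative_within_subset)
    qed (use Suc \<open>a \<le> x\<close> in \<open>auto simp: nth_deriv_def\<close>)
    then have T: "((\<lambda>t. (x - t) ^ m / fact m * ?F t) has_integral
        f x - (\<Sum>i<n. nth_deriv a b i f a * (x - a) ^ i / fact i)) {a..x}"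
      by (simp add: Suc mult_ac)
    \<comment> \<open>Accounts for the constant \<open>?F a\<close> in the remainder integrand;
      multiplied by it and divided by \<open>fact n\<close>, this is the summand of degree
      \<open>n\<close>.\<close>
    have "((\<lambda>t. - (real n * (x - t) ^ m)) has_integral (x - x) ^ n - (x - a) ^ n) {a..x}"
      using power_diff_has_derivative[of x n] \<open>a \<le> x\<close> Suc
      by (intro fundamental_theorem_of_calculus)
        (auto simp: has_real_derivative_iff_has_vector_derivative)
    from has_integral_add[OF has_integral_mult_right[OF T, of "- fact n"] has_integral_mult_right[OF this, of "- ?F a"]]
    have "((\<lambda>t. - fact n * ((x - t) ^ m / fact m * ?F t) + - ?F a * - (real n * (x - t) ^ m)) has_integral
        - fact n * (f x - (\<Sum>i<n. nth_deriv a b i f a * (x - a) ^ i / fact i)) + ?F a * (x - a) ^ n) {a..x}"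
      by (simp add: Suc del: fact_Suc of_nat_Suc)
    moreover have "- fact n * ((x - t) ^ m / fact m * ?F t) + - ?F a * - (real n * (x - t) ^ m)
        = (?F t - ?F a) * - (real n * (x - t) ^ m)" for t
    proof -
      have "fact n = real n * fact m" by (simp add: Suc)
      then show ?thesis by (simp add: field_simps)
    qed
    ultimately have "((\<lambda>t. (?F t - ?F a) * - (real n * (x - t) ^ m)) has_integral
        - fact n * (f x - (\<Sum>i<n. nth_deriv a b i f a * (x - a) ^ i / fact i)) + ?F a * (x - a) ^ n) {a..x}"
      by (simp only:)
    from integral_unique[OF this]
    have "taylor_remainder a b n f x
        = f x - (\<Sum>i<n. nth_deriv a b i f a * (x - a) ^ i / fact i) - ?F a * (x - a) ^ n / fact n"
      using R by (simp add: Suc field_simps del: fact_Suc)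
    moreover have "taylor_poly a b n f x
        = (\<Sum>i<n. nth_deriv a b i f a * (x - a) ^ i / fact i) + ?F a * (x - a) ^ n / fact n"
      by (simp add: taylor_poly_def atLeast0AtMost lessThan_Suc_atMost[symmetric])
    ultimately show ?thesis by simp
  qed
qed

section \<open>Estimates of the remainder\<close>

lemma abs_taylor_remainder_le:
  assumes "a < b" and f: "nth_deriv_continuous a b n f" and x: "x \<in> {a..b}"
    and M: "\<And>t. t \<in> {a..x} \<Longrightarrow> \<bar>nth_deriv a b n f t - nth_deriv a b n f a\<bar> \<le> M"
  shows "\<bar>taylor_remainder a b n f x\<bar> \<le> (x - a) ^ n / fact n * M"
proof -
  have F: "continuous_on {a..b} (nth_deriv a b n f)" using f by (simp add: nth_deriv_continuous_def)
  have "\<bar>dist_integral_mult a b (dist_deriv_Suc a b n f) (\<lambda>t. (x - t) ^ n) a x\<bar> \<le> M * (x - a) ^ n"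
    unfolding dist_deriv_Suc_def
    by (rule abs_dist_integral_mult_le[OF \<open>a < b\<close> F x _ power_diff_has_derivative _ _ M])
      (auto intro!: continuous_intros)
  then show ?thesis
    unfolding taylor_remainder_def by (simp add: abs_mult divide_right_mono mult.commute)
qed

text \<open>The multiplier \<open>(x - t) ^ n\<close> changes with \<open>x\<close>, so continuity
  is read off from the difference of \<open>f\<close> and the polynomial instead of from the
  integral.\<close>

lemma taylor_remainder_continuous_on:
  assumes "a < b" and f: "nth_deriv_continuous a b n f"
  shows "continuous_on {a..b} (taylor_remainder a b n f)"
proof -
  have "continuous_on {a..b} (\<lambda>x. f x - taylor_poly a b n f x)"
    unfolding taylor_poly_def
    by (intro continuous_intros nth_deriv_continuous_imp_continuous_on[OF f]) auto
  then show ?thesis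
    by (rule continuous_on_eq) (simp add: taylor_remainder_formula[OF assms])
qed

text \<open>The maximum is attained at some \<open>x\<close>; there the triangle inequality applies,
  and \<open>{a..x}\<close> is then enlarged to \<open>{a..b}\<close>.\<close>

lemma alexiewicz_norm_fun_le_L1_norm:
  assumes "a < b" and F: "continuous_on {a..b} F"
  shows "alexiewicz_norm_fun a b F \<le> L1_norm a b F"
proof -
  have cont: "continuous_on {a..b} (\<lambda>x. \<bar>integral {a..x} F\<bar>)"
    by (intro continuous_intros indefinite_integral_continuous_1 integrable_continuous_real F)
  obtain x where x: "x \<in> {a..b}" "max_on {a..b} (\<lambda>x. \<bar>integral {a..x} F\<bar>) = \<bar>integral {a..x} F\<bar>"
    using max_on_attained[OF _ _ cont] \<open>a < b\<close> by auto
  have sub: "{a..x} \<subseteq> {a..b}" using x by auto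
  note Fx = continuous_on_subset[OF F sub]
  have "\<bar>integral {a..x} F\<bar> \<le> integral {a..x} (\<lambda>t. \<bar>F t\<bar>)"
    using integral_norm_bound_integral[of F "{a..x}" "\<lambda>t. \<bar>F t\<bar>"]
    by (auto intro!: integrable_continuous_real continuous_intros Fx)
  also have "\<dots> \<le> integral {a..b} (\<lambda>t. \<bar>F t\<bar>)"
    by (rule integral_subset_le[OF sub]) (auto intro!: integrable_continuous_real continuous_intros F Fx)
  finally show ?thesis
    using x by (simp add: alexiewicz_norm_fun_def L1_norm_def)
qed

text \<open>Integrates the pointwise bound with one \<open>M\<close> for all \<open>x\<close>; an
  antiderivative of \<open>(x - a) ^ n / fact n\<close> raises both exponent and factorial by
  1.\<close>

lemma L1_norm_taylor_remainder_le:
  assumes "a < b" and f: "nth_deriv_continuous a b n f"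
    and M: "\<And>t. t \<in> {a..b} \<Longrightarrow> \<bar>nth_deriv a b n f t - nth_deriv a b n f a\<bar> \<le> M"
  shows "L1_norm a b (taylor_remainder a b n f) \<le> (b - a) ^ (n + 1) / fact (n + 1) * M"
proof -
  let ?P = "\<lambda>x. (x - a) ^ (n + 1) / fact (n + 1) * M"
  have "((\<lambda>x. (x - a) ^ n / fact n * M) has_integral ?P b - ?P a) {a..b}"
  proof (rule fundamental_theorem_of_calculus)
    show "(?P has_vector_derivative (x - a) ^ n / fact n * M) (at x within {a..b})" for x
    proof -
      have "((\<lambda>x. (x - a) ^ (n + 1)) has_real_derivative real (Suc n) * (x - a) ^ n) (at x within {a..b})"
        by (auto intro!: derivative_eq_intros simp del: power_Suc)
      from DERIV_cmult_right[OF DERIV_cdivide[OF this, of "fact (n + 1)"], of M] show ?thesis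
        unfolding has_real_derivative_iff_has_vector_derivative[symmetric]
        by (rule DERIV_cong) (simp del: of_nat_Suc)
    qed
  qed (use \<open>a < b\<close> in simp)
  then have int: "((\<lambda>x. (x - a) ^ n / fact n * M) has_integral ?P b) {a..b}" by simp
  have "integral {a..b} (\<lambda>x. \<bar>taylor_remainder a b n f x\<bar>) \<le> integral {a..b} (\<lambda>x. (x - a) ^ n / fact n * M)"
  proof (rule integral_le)
    show "(\<lambda>x. \<bar>taylor_remainder a b n f x\<bar>) integrable_on {a..b}"
      by (intro integrable_continuous_real continuous_intros taylor_remainder_continuous_on assms(1,2))
    show "\<bar>taylor_remainder a b n f x\<bar> \<le> (x - a) ^ n / fact n * M" if "x \<in> {a..b}" for x
      using that by (intro abs_taylor_remainder_le assms(1,2) M) auto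
  qed (use int in blast)
  then show ?thesis using integral_unique[OF int] by (simp add: L1_norm_def)
qed

theorem theorem27:
  fixes f :: "real \<Rightarrow> real" and a b :: real and n :: nat
  assumes "a < b"
    and "nth_deriv_continuous a b n f"
  shows
    "(\<forall>x\<in>{a..b}. f x = taylor_poly a b n f x + taylor_remainder a b n f x) \<and>
     (\<forall>x\<in>{a..b}.
        \<bar>taylor_remainder a b n f x\<bar>
          \<le> (x - a) ^ n * alexiewicz_norm a b (dist_mult a b (dist_deriv_Suc a b n f) (indicator {a..x})) / fact n \<and>
        (x - a) ^ n * alexiewicz_norm a b (dist_mult a b (dist_deriv_Suc a b n f) (indicator {a..x})) / fact n
          = (x - a) ^ n / fact n * max_on {a..x} (\<lambda>\<xi>. \<bar>nth_deriv a b n f \<xi> - nth_deriv a b n f a\<bar>) \<and>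
        (x - a) ^ n / fact n * max_on {a..x} (\<lambda>\<xi>. \<bar>nth_deriv a b n f \<xi> - nth_deriv a b n f a\<bar>)
          \<le> (x - a) ^ n * alexiewicz_norm a b (dist_deriv_Suc a b n f) / fact n) \<and>
     alexiewicz_norm_fun a b (taylor_remainder a b n f) \<le> L1_norm a b (taylor_remainder a b n f) \<and>
     L1_norm a b (taylor_remainder a b n f)
       \<le> (b - a) ^ (n + 1) / fact (n + 1) * alexiewicz_norm a b (dist_deriv_Suc a b n f) \<and>
     (b - a) ^ (n + 1) / fact (n + 1) * alexiewicz_norm a b (dist_deriv_Suc a b n f)
       = (b - a) ^ (n + 1) / fact (n + 1)
           * max_on {a..b} (\<lambda>\<xi>. \<bar>nth_deriv a b n f \<xi> - nth_deriv a b n f a\<bar>)"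
proof -
  let ?D = "\<lambda>\<xi>. \<bar>nth_deriv a b n f \<xi> - nth_deriv a b n f a\<bar>"
  have F: "continuous_on {a..b} (nth_deriv a b n f)"
    using assms by (simp add: nth_deriv_continuous_def)
  have D: "continuous_on {a..x} ?D" if "x \<in> {a..b}" for x
    using that by (intro continuous_intros continuous_on_subset[OF F]) auto
  \<comment> \<open>With \<open>x\<close> free, this gives the local bound for the pointwise
    estimate and, at \<open>x = b\<close>, the uniform one for the \<open>L1_norm\<close>.\<close>
  have le_max: "?D t \<le> max_on {a..x} ?D" if x: "x \<in> {a..b}" and t: "t \<in> {a..x}" for t x
  proof (rule max_on_attained[OF _ _ D[OF x]])
    show "?D t \<le> max_on {a..x} ?D" if "\<And>y. y \<in> {a..x} \<Longrightarrow> ?D y \<le> max_on {a..x} ?D"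
      by (rule that[OF t])
  qed (use x in auto)
  have norm: "alexiewicz_norm a b (dist_deriv_Suc a b n f) = max_on {a..b} ?D"
    unfolding dist_deriv_Suc_def by (rule alexiewicz_norm_dist_deriv[OF \<open>a < b\<close> F])
  have norm_x: "alexiewicz_norm a b (dist_mult a b (dist_deriv_Suc a b n f) (indicator {a..x}))
      = max_on {a..x} ?D" if "x \<in> {a..b}" for x
    unfolding dist_deriv_Suc_def by (rule alexiewicz_norm_restriction[OF \<open>a < b\<close> F that])
  have max_mono: "max_on {a..x} ?D \<le> max_on {a..b} ?D" if x: "x \<in> {a..b}" for x
  proof -
    have "compact {a..x}" "{a..x} \<noteq> {}" using x by auto
    then obtain t where "t \<in> {a..x}" "max_on {a..x} ?D = ?D t"
      by (rule max_on_attained[OF _ _ D[OF x]])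
    then show ?thesis using le_max[of b t] x by simp
  qed
  have "\<bar>taylor_remainder a b n f x\<bar> \<le> (x - a) ^ n / fact n * max_on {a..x} ?D"
    if "x \<in> {a..b}" for x
    using that by (intro abs_taylor_remainder_le assms le_max)
  moreover have "(x - a) ^ n / fact n * max_on {a..x} ?D \<le> (x - a) ^ n / fact n * max_on {a..b} ?D"
    if "x \<in> {a..b}" for x
    using that by (intro mult_left_mono max_mono) auto
  moreover have "L1_norm a b (taylor_remainder a b n f) \<le> (b - a) ^ (n + 1) / fact (n + 1) * max_on {a..b} ?D"
    using \<open>a < b\<close> by (intro L1_norm_taylor_remainder_le assms le_max) auto
  moreover have "alexiewicz_norm_fun a b (taylor_remainder a b n f) \<le> L1_norm a b (taylor_remainder a b n f)"
    by (intro alexiewicz_norm_fun_le_L1_norm taylor_remainder_continuous_on assms)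
  ultimately show ?thesis
    using taylor_remainder_formula[OF assms] by (simp add: norm norm_x del: fact_Suc)
qed

end
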